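(* Let $\alpha,\beta,p\in(0,1)$ and $q\in[0,1]$. Let $\gamma^1,\gamma^2,\gamma^3$ be the probability measures on $\{\pm e_1,\pm e_2\}$ with $\gamma^1(e_1)=\alpha=1-\gamma^1(e_2)$, $\gamma^2(e_1)=\beta=1-\gamma^2(e_2)$ and $\gamma^3(-e_1)=1$. Let $(\omega_x)_{x\in\mathbb{Z}^2}$ be i.i.d. with $\omega_x=\gamma^3$ with probability $p$, $\omega_x=\gamma^1$ with probability $(1-p)q$ and $\omega_x=\gamma^2$ with probability $(1-p)(1-q)$. Put $$\eta=q\alpha+(1-q)\beta,\qquad a=(1-p)\eta,\qquad \xi=\frac{q\alpha}{1-\alpha}+\frac{(1-q)\beta}{1-\beta}.$$ Let $(X_n)$ be the random walk in the random environment $\omega$ started at the origin, let $T$ be the first time it takes a step in direction $e_2$, and let $\Delta=X_T^{[1]}$ be its first coordinate at time $T$. Then $$E[\Delta]=\frac{(1-p)^2\eta}{1-a}-\frac{p}{1-p},\qquad E[T]=p(1+2\xi)+\frac{p}{1-p}+\frac{1-p}{1-a}\,(1+2p\xi),$$ and the first coordinate $n^{-1}X^{[1]}_n$ converges almost surely under $P$ to $v^{[1]}(\alpha,\beta,p,q)=E[\Delta]/E[T]$. Moreover there exist $\alpha,\beta,p\in(0,1)$ such that $q\mapsto v^{[1]}(\alpha,\beta,p,q)$ is not monotone increasing in $q$.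
   Context: $e_1=(1,0)$ and $e_2=(0,1)$ are the unit vectors of $\mathbb{Z}^2$. Given the environment $\omega=(\omega_x)_{x\in\mathbb{Z}^2}$, where each $\omega_x$ is a probability measure on $\{\pm e_1,\pm e_2\}$, the walk is the time-homogeneous Markov chain $(X_n)_{n\ge0}$ on $\mathbb{Z}^2$ with $X_0=0$ and transition probability $\omega_x(e)$ from $x$ to $x+e$. The environment is sampled once and kept fixed. $P$ denotes the annealed law, i.e. the law of the walk averaged over the environment, and $E$ its expectation. The time $T$ is the smallest $n\ge1$ with $X_n-X_{n-1}=e_2$. Superscript $[1]$ denotes the first coordinate. *)

theory Defs
  imports "HOL-Probability.Probability"
begin

section \<open>Random walk in an i.i.d. random environment on the square lattice\<close>

type_synonym site = "int \<times> int"
type_synonym env = "site \<Rightarrow> site pmf"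
type_synonym path = "nat \<Rightarrow> site"

definition e1 :: site where "e1 = (1, 0)"
definition e2 :: site where "e2 = (0, 1)"

text \<open>\<open>walk_kernel \<omega> n h\<close> is the conditional law of \<open>X\<^sub>n\<close> given that \<open>X\<^sub>0, \<dots>, X\<^sub>n\<^sub>-\<^sub>1\<close> is the history \<open>h\<close>.\<close>

definition walk_kernel :: "env \<Rightarrow> nat \<Rightarrow> (nat \<Rightarrow> site) \<Rightarrow> site measure" where
  "walk_kernel \<omega> n h = (case n of
      0 \<Rightarrow> measure_pmf (return_pmf 0)
    | Suc m \<Rightarrow> measure_pmf (map_pmf (\<lambda>e. h m + e) (\<omega> (h m))))"

definition path_space :: "path measure" where
  "path_space = (\<Pi>\<^sub>M n\<in>UNIV. count_space UNIV)"

text \<open>The law of the Markov chain in the fixed environment \<open>\<omega>\<close> is the Ionescu-Tulcea limit of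
  these kernels.\<close>

definition quenched :: "env \<Rightarrow> path measure" where
  "quenched \<omega> = projective_family.lim UNIV
     (Ionescu_Tulcea.CI (walk_kernel \<omega>) (\<lambda>_. count_space UNIV)) (\<lambda>_. count_space UNIV)"

definition env_law :: "site pmf pmf \<Rightarrow> env measure" where
  "env_law \<mu> = (\<Pi>\<^sub>M x\<in>UNIV. measure_pmf \<mu>)"

definition annealed :: "site pmf pmf \<Rightarrow> path measure" where
  "annealed \<mu> = env_law \<mu> \<bind> quenched"

subsection \<open>These laws are what they should be\<close>

lemma Ionescu_Tulcea_walk_kernel:
  "Ionescu_Tulcea (walk_kernel \<omega>) (\<lambda>_. count_space UNIV)"
proof (rule Ionescu_Tulcea.intro)
  fix i :: nat
  show "walk_kernel \<omega> i \<in> (\<Pi>\<^sub>M j\<in>{0..<i}. count_space UNIV) \<rightarrow>\<^sub>M subprob_algebra (count_space UNIV)"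
  proof (cases i)
    case 0
    then show ?thesis
      by (auto simp: walk_kernel_def[abs_def] space_subprob_algebra
          intro!: measurable_const prob_space_imp_subprob_space prob_space_measure_pmf)
  next
    case (Suc m)
    have "(\<lambda>h. h m) \<in> (\<Pi>\<^sub>M j\<in>{0..<i}. count_space UNIV) \<rightarrow>\<^sub>M (count_space UNIV :: site measure)"
      using Suc by (intro measurable_component_singleton) auto
    moreover have "(\<lambda>s. measure_pmf (map_pmf (\<lambda>e. s + e) (\<omega> s))) \<in>
       count_space UNIV \<rightarrow>\<^sub>M subprob_algebra (count_space UNIV)"
      by (auto simp: space_subprob_algebra
          intro!: prob_space_imp_subprob_space prob_space_measure_pmf)
    ultimately have "(\<lambda>h. measure_pmf (map_pmf (\<lambda>e. h m + e) (\<omega> (h m)))) \<in>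
       (\<Pi>\<^sub>M j\<in>{0..<i}. count_space UNIV) \<rightarrow>\<^sub>M subprob_algebra (count_space UNIV)"
      by (rule measurable_compose)
    then show ?thesis
      by (simp only: Suc walk_kernel_def[abs_def] nat.case)
  qed
next
  fix i :: nat and h :: "nat \<Rightarrow> site"
  show "prob_space (walk_kernel \<omega> i h)"
    by (cases i) (simp_all only: walk_kernel_def nat.case prob_space_measure_pmf)
qed

lemma prob_space_quenched: "prob_space (quenched \<omega>)"
  and sets_quenched: "sets (quenched \<omega>) = sets path_space"
proof -
  interpret Ionescu_Tulcea "walk_kernel \<omega>" "\<lambda>_. count_space UNIV"
    by (rule Ionescu_Tulcea_walk_kernel)
  show "sets (quenched \<omega>) = sets path_space"
    unfolding quenched_def path_space_def by simp
  have *: "emeasure PF.lim (PF.emb UNIV {} (space (PiM {} (\<lambda>_. count_space UNIV)))) = 1"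
  proof -
    have "space (CI {}) = space (PiM {} (\<lambda>_. count_space UNIV))"
      by (simp add: CI_def)
    then have "emeasure (CI {}) (space (PiM {} (\<lambda>_. count_space UNIV))) = 1"
      using PF.prob_space_P[of "{}", THEN prob_space.emeasure_space_1] by simp
    then show ?thesis
      by (subst lim) auto
  qed
  have "PF.emb UNIV {} (space (PiM {} (\<lambda>_. count_space UNIV))) = (space PF.lim :: path set)"
    by (auto simp: prod_emb_def space_PiM)
  with * show "prob_space (quenched \<omega>)"
    unfolding quenched_def by (intro prob_spaceI) simp
qed

lemma emeasure_quenched_cylinder:
  "emeasure (quenched \<omega>) {X. \<forall>i\<le>n. X i = x i} =
     (if x 0 = 0 then ennreal (\<Prod>i<n. pmf (\<omega> (x i)) (x (Suc i) - x i)) else 0)"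
proof -
  interpret Ionescu_Tulcea "walk_kernel \<omega>" "\<lambda>_. count_space UNIV"
    by (rule Ionescu_Tulcea_walk_kernel)
  let ?M = "\<lambda>_::nat. count_space (UNIV :: site set)"
  let ?S = "\<lambda>n. {restrict x {0..<n}}"
  have S[measurable]: "?S n \<in> sets (PiM {0..<n} ?M)" for n
  proof -
    have "?S n = PiE {0..<n} (\<lambda>i. {x i})"
      by (auto simp: PiE_def Pi_def extensional_def fun_eq_iff)
    also have "\<dots> \<in> sets (PiM {0..<n} ?M)"
      by (rule sets_PiM_I_finite) auto
    finally show ?thesis .
  qed
  have step: "emeasure (C 0 (Suc n) (\<lambda>_. undefined)) (?S (Suc n)) =
     emeasure (C 0 n (\<lambda>_. undefined)) (?S n) * emeasure (walk_kernel \<omega> n (restrict x {0..<n})) {x n}" for n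
  proof -
    have "emeasure (C 0 (Suc n) (\<lambda>_. undefined)) (?S (Suc n)) =
      (\<integral>\<^sup>+h. emeasure (eP n h) (?S (Suc n)) \<partial>C 0 n (\<lambda>_. undefined))"
      using measurable_eP[of n] S[of "Suc n"]
      by (simp, subst emeasure_bind[where N = "PiM {0..<Suc n} ?M"])
         (auto simp: space_C space_PiM measurable_cong_sets[OF sets_C])
    also have "\<dots> = (\<integral>\<^sup>+h. emeasure (walk_kernel \<omega> n (restrict x {0..<n})) {x n} *
        indicator (?S n) h \<partial>C 0 n (\<lambda>_. undefined))"
    proof (rule nn_integral_cong)
      fix h assume "h \<in> space (C 0 n (\<lambda>_. undefined))"
      then have h: "h \<in> space (PiM {0..<n} ?M)" by (simp add: space_C space_PiM)
      then have ext: "h \<in> extensional {0..<n}" by (auto simp: space_PiM PiE_def)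
      have "(\<lambda>y. h(n := y)) -` ?S (Suc n) = (if h = restrict x {0..<n} then {x n} else {})"
      proof -
        have "h(n := y) = restrict x {0..<Suc n} \<longleftrightarrow> h = restrict x {0..<n} \<and> y = x n" for y
          using ext by (auto simp: fun_eq_iff extensional_def restrict_def less_Suc_eq)
        then have "(\<lambda>y. h(n := y)) -` ?S (Suc n) = {y. h = restrict x {0..<n} \<and> y = x n}"
          unfolding vimage_def by blast
        then show ?thesis by simp
      qed
      then show "emeasure (eP n h) (?S (Suc n)) =
          emeasure (walk_kernel \<omega> n (restrict x {0..<n})) {x n} * indicator (?S n) h"
        by (subst emeasure_eP[OF h S]) (auto simp: split: if_splits)
    qed
    also have "\<dots> = emeasure (walk_kernel \<omega> n (restrict x {0..<n})) {x n} *
        emeasure (C 0 n (\<lambda>_. undefined)) (?S n)"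
      using S[of n] by (subst nn_integral_cmult_indicator) (auto simp: sets_C space_PiM)
    finally show ?thesis by (simp add: mult.commute)
  qed
  have ker: "emeasure (walk_kernel \<omega> (Suc n) (restrict x {0..<Suc n})) {x (Suc n)} =
      ennreal (pmf (\<omega> (x n)) (x (Suc n) - x n))" for n
  proof -
    have "(\<lambda>e. x n + e) -` {x (Suc n)} = {x (Suc n) - x n}"
      by (auto simp: algebra_simps)
    then show ?thesis
      by (simp add: walk_kernel_def emeasure_pmf_single pmf_map measure_pmf_single)
  qed
  have C: "emeasure (C 0 (Suc n) (\<lambda>_. undefined)) (?S (Suc n)) =
     (if x 0 = 0 then ennreal (\<Prod>i<n. pmf (\<omega> (x i)) (x (Suc i) - x i)) else 0)" for n
  proof (induction n)
    case 0
    have "emeasure (C 0 0 (\<lambda>_. undefined)) (?S 0) = 1"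
      using S[of 0] by (simp add: restrict_def)
    then show ?case
      by (subst step) (auto simp: walk_kernel_def indicator_def)
  next
    case (Suc n)
    show ?case
      by (subst step, subst Suc.IH, subst ker) (auto simp: ennreal_mult'' )
  qed
  have "{X. \<forall>i\<le>n. X i = x i} = PF.emb UNIV {0..<Suc n} (?S (Suc n))"
    by (auto simp: prod_emb_def restrict_def less_Suc_eq_le) (metis (full_types))+
  then have "emeasure (quenched \<omega>) {X. \<forall>i\<le>n. X i = x i} = emeasure (CI {0..<Suc n}) (?S (Suc n))"
    unfolding quenched_def using lim[OF _ S[of "Suc n"]] by simp
  also have "\<dots> = emeasure (C 0 (Suc n) (\<lambda>_. undefined)) (?S (Suc n))"
    by (subst emeasure_CI[OF order_refl S]) (simp add: prod_emb_id space_PiM)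
  finally show ?thesis using C by simp
qed

lemma measurable_quenched: "quenched \<in> env_law \<mu> \<rightarrow>\<^sub>M prob_algebra path_space"
proof (rule measurable_prob_algebra_generated)
  let ?G = "insert {} (range (\<lambda>(n, x). {X. \<forall>i\<le>n. X i = x i}) :: path set set)"
  show "Int_stable ?G"
  proof (rule Int_stableI)
    fix A B assume "A \<in> ?G" "B \<in> ?G"
    then show "A \<inter> B \<in> ?G"
    proof (cases "A \<inter> B = {}")
      case False
      then obtain z where z: "z \<in> A" "z \<in> B" by auto
      with \<open>A \<in> ?G\<close> \<open>B \<in> ?G\<close> obtain n x m y where
        *: "A = {X. \<forall>i\<le>n. X i = x i}" "B = {X. \<forall>i\<le>m. X i = y i}" by auto
      with z have "A = {X. \<forall>i\<le>n. X i = z i}" "B = {X. \<forall>i\<le>m. X i = z i}" by auto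
      then have "A \<inter> B = {X. \<forall>i\<le>max n m. X i = z i}" by (auto simp: le_max_iff_disj)
      then show ?thesis by auto
    qed simp
  qed
  have cyl: "{X. \<forall>i\<le>n. X i = x i} \<in> sets path_space" for n x
  proof -
    have "{X \<in> space path_space. \<forall>i\<in>{..n}. X i = x i} \<in> sets path_space"
    proof (intro sets.sets_Collect_finite_All)
      fix i
      have "(\<lambda>X. X i) \<in> path_space \<rightarrow>\<^sub>M count_space UNIV"
        unfolding path_space_def by (rule measurable_component_singleton) simp
      then have "(\<lambda>X. X i) -` {x i} \<inter> space path_space \<in> sets path_space"
        by (rule measurable_sets) simp
      also have "(\<lambda>X. X i) -` {x i} \<inter> space path_space = {X \<in> space path_space. X i = x i}"
        by auto
      finally show "{X \<in> space path_space. X i = x i} \<in> sets path_space" .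
    qed simp
    then show ?thesis
      by (simp add: path_space_def space_PiM Ball_def)
  qed
  show "sets path_space = sigma_sets UNIV ?G"
  proof (rule antisym)
    have "{X. X i = s} \<in> sigma_sets UNIV ?G" for i and s :: site
    proof -
      let ?L = "{xs :: site list. length xs = Suc i \<and> xs ! i = s}"
      have "{X. X i = s} = (\<Union>xs\<in>?L. {X. \<forall>j\<le>i. X j = xs ! j})"
      proof safe
        fix X :: path assume "s = X i"
        then show "X \<in> (\<Union>xs\<in>{xs. length xs = Suc i \<and> xs ! i = X i}. {X. \<forall>j\<le>i. X j = xs ! j})"
          by (intro UN_I[of "map X [0..<Suc i]"]) (auto simp: less_Suc_eq_le simp del: upt_Suc)
      qed auto
      also have "\<dots> \<in> sigma_sets UNIV ?G"
        by (intro sigma_sets_UNION countable_Collect countable_image) 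
           (auto intro!: sigma_sets.Basic)
      finally show ?thesis .
    qed
    note single = this
    have "{X. X i \<in> A} \<in> sigma_sets UNIV ?G" for i and A :: "site set"
    proof -
      have "{X. X i \<in> A} = (\<Union>s\<in>A. {X. X i = s})" by auto
      also have "\<dots> \<in> sigma_sets UNIV ?G"
        by (intro sigma_sets_UNION countable_image) (auto intro!: single)
      finally show ?thesis .
    qed
    note coord = this
    have "{{f \<in> UNIV \<rightarrow>\<^sub>E space (count_space UNIV). f i \<in> A} | i A.
        i \<in> UNIV \<and> A \<in> sets (count_space (UNIV :: site set))} \<subseteq> sigma_sets UNIV ?G"
    proof
      fix B :: "path set"
      assume "B \<in> {{f \<in> UNIV \<rightarrow>\<^sub>E space (count_space UNIV). f i \<in> A} | i A.
        i \<in> UNIV \<and> A \<in> sets (count_space (UNIV :: site set))}"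
      then obtain i A where "B = {X. X i \<in> A}"
        by (auto simp: PiE_UNIV_domain)
      then show "B \<in> sigma_sets UNIV ?G" by (simp only: coord)
    qed
    then show "sets path_space \<subseteq> sigma_sets UNIV ?G"
      unfolding path_space_def sets_PiM_single
      using sigma_sets_mono by (simp add: PiE_UNIV_domain)
  next
    have "?G \<subseteq> sets path_space" using cyl by auto
    then show "sigma_sets UNIV ?G \<subseteq> sets path_space"
      using sets.sigma_sets_subset[of ?G path_space] by (simp add: path_space_def space_PiM)
  qed
  show "?G \<subseteq> Pow UNIV" by simp
  show "prob_space (quenched \<omega>)" for \<omega> by (rule prob_space_quenched)
  show "sets (quenched \<omega>) = sets path_space" for \<omega> by (rule sets_quenched)
  have pmf: "(\<lambda>\<omega>. pmf (\<omega> s) d) \<in> borel_measurable (env_law \<mu>)" for s d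
    unfolding env_law_def
    by (rule measurable_compose[OF measurable_component_singleton[of s]]) auto
  have "(\<lambda>\<omega>. emeasure (quenched \<omega>) {X. \<forall>i\<le>n. X i = x i}) \<in> borel_measurable (env_law \<mu>)" for n x
  proof (cases "x 0 = 0")
    case True
    have "(\<lambda>\<omega>. ennreal (\<Prod>i<n. pmf (\<omega> (x i)) (x (Suc i) - x i))) \<in> borel_measurable (env_law \<mu>)"
      by (intro measurable_compose[OF _ measurable_ennreal] borel_measurable_prod pmf)
    with True show ?thesis
      by (simp only: emeasure_quenched_cylinder simp_thms if_True)
  qed (simp only: emeasure_quenched_cylinder if_False borel_measurable_const)
  note cylinder = this
  fix A assume "A \<in> ?G"
  then consider "A = {}" | n x where "A = {X. \<forall>i\<le>n. X i = x i}"
    by auto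
  then show "(\<lambda>\<omega>. emeasure (quenched \<omega>) A) \<in> borel_measurable (env_law \<mu>)"
  proof cases
    case 1
    then show ?thesis by (simp only: emeasure_empty borel_measurable_const)
  next
    case 2
    then show ?thesis by (simp only: cylinder)
  qed
qed

lemma prob_space_annealed: "prob_space (annealed \<mu>)"
  and sets_annealed: "sets (annealed \<mu>) = sets path_space"
proof -
  have env: "prob_space (env_law \<mu>)"
    unfolding env_law_def by (intro prob_space_PiM prob_space_measure_pmf)
  then have "env_law \<mu> \<in> space (prob_algebra (env_law \<mu>))"
    by (simp add: space_prob_algebra)
  then show "prob_space (annealed \<mu>)" "sets (annealed \<mu>) = sets path_space"
    unfolding annealed_def by (rule prob_space_bind'[OF _ measurable_quenched], rule sets_bind'[OF _ measurable_quenched])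
qed

section \<open>First step in direction \<open>e\<^sub>2\<close>\<close>

definition T :: "path \<Rightarrow> enat" where
  "T X = Inf (enat ` {n. n \<ge> 1 \<and> X n - X (n - 1) = e2})"

text \<open>On the null event \<open>T = \<infinity>\<close> the value of \<open>\<Delta>\<close> is arbitrary.\<close>

definition Delta :: "path \<Rightarrow> real" where
  "Delta X = real_of_int (fst (X (the_enat (T X))))"

section \<open>The three-valued environment\<close>

text \<open>\<open>\<gamma>\<^sup>1\<close> and \<open>\<gamma>\<^sup>2\<close> are \<open>right_up \<alpha>\<close> and \<open>right_up \<beta>\<close>.\<close>

definition right_up :: "real \<Rightarrow> site pmf" where
  "right_up r = map_pmf (\<lambda>b. if b then e1 else e2) (bernoulli_pmf r)"

definition gamma3 :: "site pmf" where
  "gamma3 = return_pmf (- e1)"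

definition site_law :: "real \<Rightarrow> real \<Rightarrow> real \<Rightarrow> real \<Rightarrow> site pmf pmf" where
  "site_law \<alpha> \<beta> p q =
     bernoulli_pmf p \<bind> (\<lambda>is3. if is3 then return_pmf gamma3
       else map_pmf (\<lambda>is1. if is1 then right_up \<alpha> else right_up \<beta>) (bernoulli_pmf q))"

definition walk_law :: "real \<Rightarrow> real \<Rightarrow> real \<Rightarrow> real \<Rightarrow> path measure" where
  "walk_law \<alpha> \<beta> p q = annealed (site_law \<alpha> \<beta> p q)"

definition E_Delta :: "real \<Rightarrow> real \<Rightarrow> real \<Rightarrow> real \<Rightarrow> real" where
  "E_Delta \<alpha> \<beta> p q = (\<integral>X. Delta X \<partial>walk_law \<alpha> \<beta> p q)"

definition E_T :: "real \<Rightarrow> real \<Rightarrow> real \<Rightarrow> real \<Rightarrow> ennreal" where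
  "E_T \<alpha> \<beta> p q = (\<integral>\<^sup>+X. ennreal_of_enat (T X) \<partial>walk_law \<alpha> \<beta> p q)"

definition v1 :: "real \<Rightarrow> real \<Rightarrow> real \<Rightarrow> real \<Rightarrow> real" where
  "v1 \<alpha> \<beta> p q = E_Delta \<alpha> \<beta> p q / enn2real (E_T \<alpha> \<beta> p q)"

end

(* Until its first e2-step the walk stays in one row: it runs left through a block of traps, or
   right through non-trap sites, then bounces some number of times between the last non-trap site
   and the neighbouring trap, and finally steps up.  So the steps up to time T form a word
   L^(k+1) (RL)^n U or R^k (RL)^n U in the letters L = -e1, R = e1, U = e2.  Each
   such word visits every site of its row in a way whose annealed weight is an explicit product, and
   these weights already sum to 1, so every other behaviour is null.  Rows are independent and words
   are prefix-free, hence the walk is in law the concatenation of i.i.d. words.  The strong law for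
   the durations and displacements of the words and a renewal argument then give the speed. *)
theory Submission
  imports Defs "HOL-Real_Asymp.Real_Asymp" "HOL-Library.Discrete_Functions"
begin

text \<open>The environment is not resampled, so a site left several times contributes the mean of a
  product of its transition probabilities and not a product of means. Averages are therefore taken
  site by site. Only the two sites between which the walk bounces can be left more than once, and
  the mean of \<open>r ^ n * (1 - r)\<close> over the non-trap types is what produces
  \<open>\<xi>\<close>. To identify the law of the walk, the i.i.d. block measure is pushed to path
  space. It gives every cylinder of words the same mass as the annealed law, and these cylinders
  exhaust the block side. This bounds the pushed measure by the annealed law on every event that
  depends on finitely many times; the same bound for the complement forces equality. From then on
  \<open>T\<close>, \<open>Delta\<close> and the speed are computed on block sequences, where
  \<open>T\<close> is finite at every point.\<close>

section \<open>A strong law of large numbers\<close>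

text \<open>Consecutive squares have ratio tending to 1, so monotonicity squeezes
  \<open>S n / n\<close> between quotients taken at the two squares around \<open>n\<close>.\<close>

lemma LIMSEQ_divide_of_squares:
  fixes S :: "nat \<Rightarrow> real"
  assumes mono: "mono S" and nonneg: "\<And>n. 0 \<le> S n"
    and lim: "(\<lambda>k. S (k\<^sup>2) / real (k\<^sup>2)) \<longlonglongrightarrow> m"
  shows "(\<lambda>n. S n / real n) \<longlonglongrightarrow> m"
proof -
  have r: "(\<lambda>k. (real (Suc k))\<^sup>2 / (real k)\<^sup>2) \<longlonglongrightarrow> 1" "(\<lambda>k. (real k)\<^sup>2 / (real (Suc k))\<^sup>2) \<longlonglongrightarrow> 1"
    by real_asymp+
  have "(\<lambda>k. S (k\<^sup>2) / real (k\<^sup>2) * ((real k)\<^sup>2 / (real (Suc k))\<^sup>2)) \<longlonglongrightarrow> m * 1"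
    by (intro tendsto_mult lim r)
  moreover have "S (k\<^sup>2) / real (k\<^sup>2) * ((real k)\<^sup>2 / (real (Suc k))\<^sup>2) = S (k\<^sup>2) / (real (Suc k))\<^sup>2" if "k > 0" for k
    using that by simp
  ultimately have lo: "(\<lambda>k. S (k\<^sup>2) / (real (Suc k))\<^sup>2) \<longlonglongrightarrow> m"
    unfolding mult_1_right
    by - (rule Lim_transform_eventually, assumption, rule eventually_mono[OF eventually_gt_at_top[of 0]])
  have "(\<lambda>k. S ((Suc k)\<^sup>2) / real ((Suc k)\<^sup>2) * ((real (Suc k))\<^sup>2 / (real k)\<^sup>2)) \<longlonglongrightarrow> m * 1"
    by (intro tendsto_mult lim[THEN LIMSEQ_Suc] r)
  moreover have "S ((Suc k)\<^sup>2) / real ((Suc k)\<^sup>2) * ((real (Suc k))\<^sup>2 / (real k)\<^sup>2) = S ((Suc k)\<^sup>2) / (real k)\<^sup>2" for k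
    by simp
  ultimately have hi: "(\<lambda>k. S ((Suc k)\<^sup>2) / (real k)\<^sup>2) \<longlonglongrightarrow> m"
    by (simp only: mult_1_right)
  have inf: "filterlim floor_sqrt at_top sequentially"
    unfolding filterlim_at_top
  proof
    fix Z
    show "\<forall>\<^sub>F n in sequentially. Z \<le> floor_sqrt n"
      by (rule eventually_mono[OF eventually_ge_at_top[of "Z\<^sup>2"]]) (simp add: le_floor_sqrt_iff)
  qed
  show ?thesis
  proof (rule tendsto_sandwich)
    show "(\<lambda>n. S ((floor_sqrt n)\<^sup>2) / (real (Suc (floor_sqrt n)))\<^sup>2) \<longlonglongrightarrow> m"
      by (rule filterlim_compose[OF lo inf])
    show "(\<lambda>n. S ((Suc (floor_sqrt n))\<^sup>2) / (real (floor_sqrt n))\<^sup>2) \<longlonglongrightarrow> m"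
      by (rule filterlim_compose[OF hi inf])
    show "\<forall>\<^sub>F n in sequentially. S ((floor_sqrt n)\<^sup>2) / (real (Suc (floor_sqrt n)))\<^sup>2 \<le> S n / real n"
    proof (rule eventually_mono[OF eventually_gt_at_top[of 0]])
      fix n :: nat assume "0 < n"
      have "n < (Suc (floor_sqrt n))\<^sup>2" by (rule Suc_floor_sqrt_power2_gt)
      then have "real n \<le> (real (Suc (floor_sqrt n)))\<^sup>2"
        by (metis less_imp_le of_nat_le_iff of_nat_power)
      moreover have "S ((floor_sqrt n)\<^sup>2) \<le> S n"
        by (intro monoD[OF mono]) simp
      ultimately show "S ((floor_sqrt n)\<^sup>2) / (real (Suc (floor_sqrt n)))\<^sup>2 \<le> S n / real n"
        using \<open>0 < n\<close> by (intro frac_le nonneg) auto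
    qed
    show "\<forall>\<^sub>F n in sequentially. S n / real n \<le> S ((Suc (floor_sqrt n))\<^sup>2) / (real (floor_sqrt n))\<^sup>2"
    proof (rule eventually_mono[OF eventually_gt_at_top[of 0]])
      fix n :: nat assume n: "0 < n"
      have "(floor_sqrt n)\<^sup>2 \<le> n" by simp
      then have "(real (floor_sqrt n))\<^sup>2 \<le> real n"
        by (metis of_nat_le_iff of_nat_power)
      moreover have "S n \<le> S ((Suc (floor_sqrt n))\<^sup>2)"
        using Suc_floor_sqrt_power2_gt[of n] by (intro monoD[OF mono]) simp
      moreover have "0 < floor_sqrt n" using n by simp
      ultimately show "S n / real n \<le> S ((Suc (floor_sqrt n))\<^sup>2) / (real (floor_sqrt n))\<^sup>2"
        using n by (intro frac_le nonneg) auto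
    qed
  qed
qed

text \<open>Bienayme's identity: after centering, independence factors every off-diagonal product
  into two zero means, so only the diagonal survives.\<close>

lemma (in prob_space) expectation_square_sum_centered:
  fixes X :: "nat \<Rightarrow> 'a \<Rightarrow> real"
  assumes indep: "indep_vars (\<lambda>_. borel) X UNIV"
    and sq: "\<And>i. integrable M (\<lambda>\<omega>. (X i \<omega>)\<^sup>2)"
  shows "integrable M (\<lambda>\<omega>. (\<Sum>i<n. X i \<omega> - expectation (X i))\<^sup>2)"
    and "expectation (\<lambda>\<omega>. (\<Sum>i<n. X i \<omega> - expectation (X i))\<^sup>2) = (\<Sum>i<n. variance (X i))"
proof -
  define Y where "Y i \<omega> = X i \<omega> - expectation (X i)" for i \<omega>
  have rv[measurable]: "X i \<in> borel_measurable M" for i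
    using indep by (auto simp: indep_vars_def)
  have int[simp]: "integrable M (X i)" for i
    by (rule square_integrable_imp_integrable[OF rv sq])
  have intY[simp]: "integrable M (Y i)" and Y0: "expectation (Y i) = 0" for i
    unfolding Y_def[abs_def] by (auto simp: prob_space)
  have Ysq: "integrable M (\<lambda>\<omega>. Y i \<omega> * Y i \<omega>)" for i
    using sq[of i] by (auto simp: Y_def algebra_simps power2_eq_square)
  have ind: "indep_vars (\<lambda>_. borel) Y {i, j}" for i j
  proof -
    have "indep_vars (\<lambda>_. borel) (\<lambda>i \<omega>. X i \<omega> - expectation (X i)) UNIV"
      by (rule indep_vars_compose2[OF indep]) auto
    then show ?thesis
      unfolding Y_def[abs_def] by (rule indep_vars_subset) auto
  qed
  have prod: "integrable M (\<lambda>\<omega>. Y i \<omega> * Y j \<omega>)" for i j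
    using Ysq[of i] indep_vars_integrable[OF _ ind[of i j]] by (cases "i = j") auto
  have cov: "expectation (\<lambda>\<omega>. Y i \<omega> * Y j \<omega>) = (if i = j then variance (X i) else 0)" for i j
    using indep_vars_lebesgue_integral[OF _ ind[of i j]]
    by (cases "i = j") (auto simp: Y0, simp add: Y_def power2_eq_square)
  have eq: "(\<Sum>i<n. X i \<omega> - expectation (X i))\<^sup>2 = (\<Sum>i<n. \<Sum>j<n. Y i \<omega> * Y j \<omega>)" for \<omega>
    by (simp add: Y_def power2_eq_square sum_product)
  show "integrable M (\<lambda>\<omega>. (\<Sum>i<n. X i \<omega> - expectation (X i))\<^sup>2)"
    unfolding eq by (intro Bochner_Integration.integrable_sum prod)
  show "expectation (\<lambda>\<omega>. (\<Sum>i<n. X i \<omega> - expectation (X i))\<^sup>2) = (\<Sum>i<n. variance (X i))"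
    unfolding eq by (simp add: Bochner_Integration.integral_sum prod cov)
qed

text \<open>Along the squares the second moments of the deviations are summable, so almost surely
  the deviations themselves tend to 0 there. Nonnegativity makes the partial sums monotone, which
  fills the gaps between squares.\<close>

lemma (in prob_space) strong_law_nonneg:
  fixes X :: "nat \<Rightarrow> 'a \<Rightarrow> real"
  assumes indep: "indep_vars (\<lambda>_. borel) X UNIV"
    and sq: "\<And>i. integrable M (\<lambda>\<omega>. (X i \<omega>)\<^sup>2)"
    and m: "\<And>i. expectation (X i) = m" and v: "\<And>i. variance (X i) \<le> v"
    and nonneg: "\<And>i \<omega>. 0 \<le> X i \<omega>"
  shows "AE \<omega> in M. (\<lambda>n. (\<Sum>i<n. X i \<omega>) / real n) \<longlonglongrightarrow> m"
proof -
  have [measurable]: "X i \<in> borel_measurable M" for i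
    using indep by (auto simp: indep_vars_def)
  \<comment> \<open>Squared deviation of the average of the first \<open>(k + 1)^2\<close>
    variables; its mean is at most \<open>v / (k + 1)^2\<close>. The shift by one avoids the empty
    average.\<close>
  define Z where "Z k \<omega> = ((\<Sum>i<(Suc k)\<^sup>2. X i \<omega> - m) / real ((Suc k)\<^sup>2))\<^sup>2" for k \<omega>
  have [measurable]: "Z k \<in> borel_measurable M" for k
    unfolding Z_def by measurable
  have "v \<ge> 0" using v[of 0] variance_positive[of "X 0"] by linarith
  have "(\<integral>\<^sup>+\<omega>. ennreal (Z k \<omega>) \<partial>M) \<le> ennreal (v * inverse (real (Suc k) ^ 2))" for k
  proof -
    let ?n = "(Suc k)\<^sup>2"
    have Z: "Z k = (\<lambda>\<omega>. (\<Sum>i<?n. X i \<omega> - expectation (X i))\<^sup>2 / (real ?n)\<^sup>2)"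
      by (simp add: Z_def m power_divide fun_eq_iff)
    have "integrable M (Z k)"
      unfolding Z by (rule integrable_divide_zero) (rule expectation_square_sum_centered(1)[OF indep sq])
    then have "(\<integral>\<^sup>+\<omega>. ennreal (Z k \<omega>) \<partial>M) = ennreal (expectation (Z k))"
      by (rule nn_integral_eq_integral) (simp add: Z_def)
    also have "expectation (Z k) = (\<Sum>i<?n. variance (X i)) / (real ?n)\<^sup>2"
      unfolding Z by (simp only: integral_divide_zero expectation_square_sum_centered(2)[OF indep sq])
    also have "\<dots> \<le> (\<Sum>i<?n. v) / (real ?n)\<^sup>2"
      by (intro divide_right_mono sum_mono v) auto
    also have "\<dots> = v * inverse (real (Suc k) ^ 2)"
      by (simp only: sum_constant card_lessThan of_nat_power) (simp add: power2_eq_square divide_simps del: of_nat_Suc)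
    finally show ?thesis by (simp add: ennreal_leI del: of_nat_Suc)
  qed
  then have "(\<integral>\<^sup>+\<omega>. (\<Sum>k. ennreal (Z k \<omega>)) \<partial>M) \<le> (\<Sum>k. ennreal (v * inverse (real (Suc k) ^ 2)))"
    by (subst nn_integral_suminf) (auto intro!: suminf_le)
  also have "\<dots> < \<infinity>"
  proof -
    have "summable (\<lambda>k. v * inverse (real (Suc k) ^ 2))"
      using inverse_power_summable[of 2, where 'a=real]
      by (intro summable_mult summable_Suc_iff[THEN iffD2]) auto
    then show ?thesis
      using \<open>v \<ge> 0\<close> by (subst suminf_ennreal2) auto
  qed
  finally have "AE \<omega> in M. (\<Sum>k. ennreal (Z k \<omega>)) \<noteq> \<infinity>"
    by (intro nn_integral_noteq_infinite) auto
  then show ?thesis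
  proof eventually_elim
    case (elim \<omega>)
    have "summable (\<lambda>k. Z k \<omega>)"
      using elim by (intro summable_suminf_not_top) (auto simp: Z_def)
    then have "(\<lambda>k. sqrt (Z k \<omega>)) \<longlonglongrightarrow> sqrt 0"
      by (intro tendsto_real_sqrt summable_LIMSEQ_zero)
    then have "(\<lambda>k. \<bar>(\<Sum>i<(Suc k)\<^sup>2. X i \<omega> - m) / real ((Suc k)\<^sup>2)\<bar>) \<longlonglongrightarrow> 0"
      by (simp only: Z_def real_sqrt_abs real_sqrt_zero)
    then have "(\<lambda>k. (\<Sum>i<(Suc k)\<^sup>2. X i \<omega> - m) / real ((Suc k)\<^sup>2)) \<longlonglongrightarrow> 0"
      by (simp only: tendsto_rabs_zero_iff)
    then have "(\<lambda>k. (\<Sum>i<(Suc k)\<^sup>2. X i \<omega> - m) / real ((Suc k)\<^sup>2) + m) \<longlonglongrightarrow> 0 + m"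
      by (intro tendsto_add tendsto_const)
    moreover have "(\<Sum>i<(Suc k)\<^sup>2. X i \<omega> - m) / real ((Suc k)\<^sup>2) + m = (\<Sum>i<(Suc k)\<^sup>2. X i \<omega>) / real ((Suc k)\<^sup>2)" for k
      by (simp add: sum_subtractf diff_divide_distrib del: of_nat_Suc)
    ultimately have "(\<lambda>k. (\<Sum>i<k\<^sup>2. X i \<omega>) / real (k\<^sup>2)) \<longlonglongrightarrow> m"
      by - (rule LIMSEQ_imp_Suc, simp only: add_0)
    then show ?case
      by (intro LIMSEQ_divide_of_squares monoI sum_mono2 sum_nonneg) (auto simp: nonneg)
  qed
qed

section \<open>From averages over renewal periods to averages over time\<close>

lemma renewal_LIMSEQ:
  fixes S :: "nat \<Rightarrow> nat" and R x :: "nat \<Rightarrow> real"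
  assumes S0: "S 0 = 0" and S: "strict_mono S" and \<tau>: "0 < \<tau>"
    and limS: "(\<lambda>k. real (S k) / real k) \<longlonglongrightarrow> \<tau>" and limR: "(\<lambda>k. R k / real k) \<longlonglongrightarrow> \<delta>"
    and x: "\<And>k n. S k \<le> n \<Longrightarrow> n < S (Suc k) \<Longrightarrow> \<bar>x n - R k\<bar> \<le> real (n - S k)"
  shows "(\<lambda>n. x n / real n) \<longlonglongrightarrow> \<delta> / \<tau>"
proof -
  text \<open>\<open>K n\<close> counts the renewals up to time \<open>n\<close>, so that \<open>x n\<close> is within one renewal
    period of \<open>R (K n)\<close>, while \<open>n\<close> lies between \<open>S (K n)\<close> and \<open>S (Suc (K n))\<close>.\<close>
  define K where "K n = (GREATEST k. S k \<le> n)" for n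
  have le: "k \<le> S k" for k using S by (rule strict_mono_imp_increasing)
  have bdd: "S k \<le> n \<Longrightarrow> k \<le> n" for k n using le[of k] by linarith
  have K1: "S (K n) \<le> n" for n
    unfolding K_def by (rule GreatestI_nat[of _ 0 n]) (auto simp: S0 bdd)
  have K_ge: "k \<le> K n" if "S k \<le> n" for k n
    unfolding K_def by (rule Greatest_le_nat[of _ k n]) (auto simp: that bdd)
  have K2: "n < S (Suc (K n))" for n
    using K_ge[of "Suc (K n)" n] by (meson not_less not_less_eq_eq order_refl)
  have inf: "filterlim K at_top sequentially"
    unfolding filterlim_at_top
  proof
    fix Z
    show "\<forall>\<^sub>F n in sequentially. Z \<le> K n"
      by (rule eventually_mono[OF eventually_ge_at_top[of "S Z"]]) (rule K_ge)
  qed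
  have pos: "\<forall>\<^sub>F n in sequentially. 0 < K n"
    using inf unfolding filterlim_at_top by (auto elim!: allE[of _ 1] eventually_mono)
  have "(\<lambda>k. real (S (Suc k)) / real (Suc k) * (real (Suc k) / real k)) \<longlonglongrightarrow> \<tau> * 1"
    by (intro tendsto_mult limS[THEN LIMSEQ_Suc]) real_asymp
  then have limS': "(\<lambda>k. real (S (Suc k)) / real k) \<longlonglongrightarrow> \<tau>"
    by (simp del: of_nat_Suc)
  have n: "(\<lambda>n. real n / real (K n)) \<longlonglongrightarrow> \<tau>"
  proof (rule tendsto_sandwich)
    show "(\<lambda>n. real (S (K n)) / real (K n)) \<longlonglongrightarrow> \<tau>" "(\<lambda>n. real (S (Suc (K n))) / real (K n)) \<longlonglongrightarrow> \<tau>"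
      by (rule filterlim_compose[OF limS inf], rule filterlim_compose[OF limS' inf])
    show "\<forall>\<^sub>F n in sequentially. real (S (K n)) / real (K n) \<le> real n / real (K n)"
      using K1 by (intro always_eventually allI divide_right_mono) auto
    show "\<forall>\<^sub>F n in sequentially. real n / real (K n) \<le> real (S (Suc (K n))) / real (K n)"
      using K2 by (intro always_eventually allI divide_right_mono) (auto simp: less_imp_le)
  qed
  \<comment> \<open>Both quotients have the limit \<open>\<tau>\<close>, so the time elapsed in the
    current period is negligible against \<open>K n\<close>, and with it the distance from
    \<open>x n\<close> to \<open>R (K n)\<close>.\<close>
  have "(\<lambda>n. real n / real (K n) - real (S (K n)) / real (K n)) \<longlonglongrightarrow> \<tau> - \<tau>"
    by (intro tendsto_diff n filterlim_compose[OF limS inf])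
  then have d: "(\<lambda>n. real (n - S (K n)) / real (K n)) \<longlonglongrightarrow> 0"
    using K1 by (simp add: of_nat_diff diff_divide_distrib)
  have "(\<lambda>n. (x n - R (K n)) / real (K n)) \<longlonglongrightarrow> 0"
  proof (rule Lim_null_comparison[OF _ d])
    show "\<forall>\<^sub>F n in sequentially. norm ((x n - R (K n)) / real (K n)) \<le> real (n - S (K n)) / real (K n)"
      using x[OF K1 K2] by (auto intro!: always_eventually divide_right_mono)
  qed
  then have "(\<lambda>n. (x n - R (K n)) / real (K n) + R (K n) / real (K n)) \<longlonglongrightarrow> 0 + \<delta>"
    by (intro tendsto_add filterlim_compose[OF limR inf])
  then have "(\<lambda>n. (x n / real (K n)) / (real n / real (K n))) \<longlonglongrightarrow> \<delta> / \<tau>"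
    using \<tau> n by (intro tendsto_divide) (auto simp: diff_divide_distrib)
  then show ?thesis
  proof (rule Lim_transform_eventually)
    show "\<forall>\<^sub>F n in sequentially. (x n / real (K n)) / (real n / real (K n)) = x n / real n"
      using pos by eventually_elim auto
  qed
qed

section \<open>Concatenated words\<close>

text \<open>The flag tells whether the row is entered at a trap, and the last entry counts bounces.
  A leftward run has length \<open>k + 1\<close>, at least one, so that a word without a straight
  run is coded only once, with flag \<open>False\<close>.\<close>

type_synonym block = "bool \<times> nat \<times> nat"

fun word :: "block \<Rightarrow> site list" where
  "word (b, k, n) = (if b then replicate (Suc k) (- e1) else replicate k e1)
     @ concat (replicate n [e1, - e1]) @ [e2]"

fun disp :: "block \<Rightarrow> int" where
  "disp (b, k, n) = (if b then - int (Suc k) else int k)"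

fun dur :: "block \<Rightarrow> nat" where
  "dur (b, k, n) = (if b then Suc k else k) + 2 * n + 1"

definition words :: "block list \<Rightarrow> site list" where
  "words Bs = concat (map word Bs)"

lemma words_simps [simp]: "words [] = []" "words (B # Bs) = word B @ words Bs"
  "words (Bs @ Cs) = words Bs @ words Cs"
  by (simp_all add: words_def)

lemma step_neq: "e1 \<noteq> e2" "- e1 \<noteq> e2" "e1 \<noteq> - e1"
  by (simp_all add: e1_def e2_def)

lemma length_word: "length (word B) = dur B"
  by (cases B) (simp add: length_concat sum_list_replicate)

lemma dur_pos [simp]: "0 < dur B"
  by (cases B) simp

lemma length_le_words: "length Bs \<le> length (words Bs)"
proof (induction Bs)
  case (Cons B Bs)
  then show ?case using dur_pos[of B] by (simp add: length_word del: dur_pos Suc_leI)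
qed simp

lemma sum_list_replicate_e1: "sum_list (replicate m e1) = (int m, 0)" "sum_list (replicate m (- e1)) = (- int m, 0)"
  by (induction m) (auto simp: e1_def zero_prod_def)

lemma sum_list_bounces: "sum_list (concat (replicate n [e1, - e1])) = 0"
  by (induction n) auto

lemma sum_list_word: "sum_list (word B) = (disp B, 1)"
  by (cases B) (simp add: sum_list_replicate_e1 sum_list_bounces e2_def del: replicate_Suc)

lemma word_eq_butlast: "word B = butlast (word B) @ [e2]"
  and e2_notin_butlast_word: "e2 \<notin> set (butlast (word B))"
  by (cases B; auto simp: butlast_append step_neq step_neq[symmetric])+

text \<open>The displacement of a word reveals the flag and \<open>k\<close>; the duration then
  reveals \<open>n\<close>.\<close>

lemma inj_word: "word B = word C \<Longrightarrow> B = C"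
proof -
  assume *: "word B = word C"
  then have "disp B = disp C" "dur B = dur C"
    using sum_list_word[of B] sum_list_word[of C] length_word[of B] length_word[of C] by auto
  then show "B = C"
    by (cases B; cases C) (auto split: if_splits)
qed

lemma word_nth: "word B ! (dur B - 1) = e2" "i < dur B - 1 \<Longrightarrow> word B ! i \<noteq> e2"
proof -
  have len: "length (butlast (word B)) = dur B - 1" by (simp add: length_word)
  have "(butlast (word B) @ [e2]) ! (dur B - 1) = e2"
    by (simp only: nth_append_length len[symmetric])
  then show "word B ! (dur B - 1) = e2"
    by (simp only: word_eq_butlast[symmetric])
  assume "i < dur B - 1"
  then have "word B ! i \<in> set (butlast (word B))"
    using len by (metis nth_butlast nth_mem)
  then show "word B ! i \<noteq> e2" using e2_notin_butlast_word by metis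
qed

text \<open>A word ends at its first \<open>e2\<close>, so no word is a proper prefix of another,
  and blocks can be decoded one at a time from a common sequence of steps. This makes the cylinders
  of distinct block lists of equal length disjoint.\<close>

lemma words_prefix_unique:
  assumes "\<And>i. i < length (words Bs) \<Longrightarrow> f i = words Bs ! i"
    and "\<And>i. i < length (words Cs) \<Longrightarrow> f i = words Cs ! i" and "length Bs = length Cs"
  shows "Bs = Cs"
  using assms(3,1,2)
proof (induction Bs Cs arbitrary: f rule: list_induct2)
  case (Cons B Bs C Cs)
  have 1: "f i = word B ! i" if "i < dur B" for i
    using Cons.prems(1)[of i] that by (simp add: nth_append length_word)
  have 2: "f i = word C ! i" if "i < dur C" for i
    using Cons.prems(2)[of i] that by (simp add: nth_append length_word)
  have "dur B = dur C"
  proof (rule linorder_cases[of "dur B" "dur C"])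
    assume l: "dur B < dur C"
    then have "dur B - 1 < dur C - 1" "dur B - 1 < dur C" "dur B - 1 < dur B"
      using dur_pos[of B] by linarith+
    then show ?thesis
      using word_nth(1)[of B] word_nth(2)[of "dur B - 1" C] 1[of "dur B - 1"] 2[of "dur B - 1"] by simp
  next
    assume l: "dur C < dur B"
    then have "dur C - 1 < dur B - 1" "dur C - 1 < dur B" "dur C - 1 < dur C"
      using dur_pos[of C] by linarith+
    then show ?thesis
      using word_nth(1)[of C] word_nth(2)[of "dur C - 1" B] 1[of "dur C - 1"] 2[of "dur C - 1"] by simp
  qed
  then have "word B = word C"
    by (intro nth_equalityI) (metis length_word, metis 1 2 length_word)
  then have BC: "B = C" by (rule inj_word)
  have "Bs = Cs"
  proof (rule Cons.IH[of "\<lambda>i. f (i + dur B)"])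
    show "f (i + dur B) = words Bs ! i" if "i < length (words Bs)" for i
      using Cons.prems(1)[of "i + dur B"] that by (simp add: nth_append length_word)
    show "f (i + dur B) = words Cs ! i" if "i < length (words Cs)" for i
      using Cons.prems(2)[of "i + dur B"] that BC by (simp add: nth_append length_word)
  qed
  with BC show ?case by simp
qed simp

text \<open>Every word has at least one letter, so the first \<open>n\<close> blocks already
  determine the first \<open>n\<close> steps.\<close>

definition block_walk :: "(nat \<Rightarrow> block) \<Rightarrow> path" where
  "block_walk w n = sum_list (take n (words (map w [0..<n])))"

lemma block_walk_eq:
  assumes "n \<le> length (words (map w [0..<m]))"
  shows "block_walk w n = sum_list (take n (words (map w [0..<m])))"
proof -
  have aux: "take n (words (map w [0..<m + j])) = take n (words (map w [0..<m]))"
    if "n \<le> length (words (map w [0..<m]))" for m j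
    using that by (simp add: upt_add_eq_append[of 0])
  have n: "n \<le> length (words (map w [0..<n]))"
    using length_le_words[of "map w [0..<n]"] by simp
  show ?thesis
    using aux[OF n, of "m - n"] aux[OF assms, of "n - m"] unfolding block_walk_def
    by (cases "n \<le> m") auto
qed

definition block_time :: "(nat \<Rightarrow> block) \<Rightarrow> nat \<Rightarrow> nat" where
  "block_time w k = (\<Sum>i<k. dur (w i))"

lemma length_words_map: "length (words (map w [0..<m])) = block_time w m"
  by (induction m) (simp_all add: block_time_def length_word)

lemma sum_list_words_map: "sum_list (words (map w [0..<m])) = ((\<Sum>i<m. disp (w i)), int m)"
  by (induction m) (simp_all add: sum_list_word zero_prod_def)

lemma block_walk_block_time: "block_walk w (block_time w m) = ((\<Sum>i<m. disp (w i)), int m)"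
  by (subst block_walk_eq[of _ _ m]) (simp_all add: length_words_map flip: sum_list_words_map)

lemma block_walk_Suc:
  assumes "n < block_time w m"
  shows "block_walk w (Suc n) = block_walk w n + words (map w [0..<m]) ! n"
  using assms by (subst (1 2) block_walk_eq[of _ _ m]) (simp_all add: length_words_map take_Suc_conv_app_nth)

lemma set_word: "e \<in> set (word B) \<Longrightarrow> e \<in> {e1, - e1, e2}"
  by (cases B) (auto split: if_splits)

lemma set_words: "e \<in> set (words Bs) \<Longrightarrow> e \<in> {e1, - e1, e2}"
  unfolding words_def set_concat set_map by (elim UnionE imageE) (simp only: set_word)

lemma abs_fst_block_walk_diff_le:
  "m \<le> n \<Longrightarrow> \<bar>fst (block_walk w n) - fst (block_walk w m)\<bar> \<le> int (n - m)"
proof (induction n rule: dec_induct)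
  case (step n)
  have "length (words (map w [0..<Suc n])) > n"
    using length_le_words[of "map w [0..<Suc n]"] by simp
  then have n: "n < block_time w (Suc n)" by (simp only: length_words_map)
  then have "words (map w [0..<Suc n]) ! n \<in> {e1, - e1, e2}"
    by (intro set_words[OF nth_mem]) (simp only: length_words_map)
  then have "\<bar>fst (words (map w [0..<Suc n]) ! n)\<bar> \<le> 1"
    by (auto simp: e1_def e2_def)
  then have "\<bar>fst (block_walk w (Suc n)) - fst (block_walk w n)\<bar> \<le> 1"
    by (simp only: block_walk_Suc[OF n] fst_add add_diff_cancel_left')
  then show ?case
    using step by linarith
qed simp

text \<open>The first letter \<open>e2\<close> of the concatenation is the one that closes the first
  word. This holds for every block sequence, without an exceptional null set.\<close>

lemma T_block_walk: "T (block_walk w) = enat (dur (w 0))"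
proof -
  have step: "block_walk w n - block_walk w (n - 1) = word (w 0) ! (n - 1)" if "1 \<le> n" "n \<le> dur (w 0)" for n
    using block_walk_Suc[of "n - 1" w 1] that by (simp add: block_time_def)
  let ?S = "{n. n \<ge> 1 \<and> block_walk w n - block_walk w (n - 1) = e2}"
  have "dur (w 0) \<in> ?S"
    using step[of "dur (w 0)"] word_nth(1)[of "w 0"] by (simp add: Suc_leI)
  moreover have "dur (w 0) \<le> n" if "n \<in> ?S" for n
  proof (rule ccontr)
    assume "\<not> dur (w 0) \<le> n"
    with that have "n - 1 < dur (w 0) - 1" "1 \<le> n" "n \<le> dur (w 0)" by auto
    with that step[of n] word_nth(2)[of "n - 1" "w 0"] show False by auto
  qed
  ultimately show ?thesis
    unfolding T_def by (intro antisym Inf_lower Inf_greatest) auto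
qed

lemma Delta_block_walk: "Delta (block_walk w) = real_of_int (disp (w 0))"
  using block_walk_block_time[of w 1] by (simp add: Delta_def T_block_walk block_time_def)

lemma strict_mono_block_time: "strict_mono (block_time w)"
  by (rule strict_mono_Suc_iff[THEN iffD2]) (simp add: block_time_def)

section \<open>Annealed weight of a word\<close>

fun path_weight :: "env \<Rightarrow> site \<Rightarrow> site list \<Rightarrow> real" where
  "path_weight \<omega> s [] = 1"
| "path_weight \<omega> s (e # es) = pmf (\<omega> s) e * path_weight \<omega> (s + e) es"

lemma path_weight_append:
  "path_weight \<omega> s (l @ l') = path_weight \<omega> s l * path_weight \<omega> (s + sum_list l) l'"
  by (induction l arbitrary: s) (auto simp: ac_simps)

lemma path_weight_eq_prod:
  "path_weight \<omega> s l = (\<Prod>i<length l. pmf (\<omega> (s + sum_list (take i l))) (l ! i))"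
proof (induction l arbitrary: s)
  case (Cons e l)
  then show ?case
    by (simp add: prod.lessThan_Suc_shift add.assoc del: prod.lessThan_Suc)
qed simp

lemma path_weight_replicate:
  "path_weight \<omega> (x, y) (replicate m e1) = (\<Prod>i<m. pmf (\<omega> (x + int i, y)) e1)"
  "path_weight \<omega> (x, y) (replicate m (- e1)) = (\<Prod>i<m. pmf (\<omega> (x - int i, y)) (- e1))"
  by (simp_all add: path_weight_eq_prod sum_list_replicate_e1 take_replicate min_absorb1 less_imp_le)

lemma path_weight_bounces:
  "path_weight \<omega> (x, y) (concat (replicate n [e1, - e1])) =
     (pmf (\<omega> (x, y)) e1 * pmf (\<omega> (x + 1, y)) (- e1)) ^ n"
proof (induction n)
  case (Suc n)
  have "(x, y) + e1 = (x + 1, y)" "(x + 1, y) + - e1 = (x, y)"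
    by (auto simp: e1_def)
  then show ?case by (simp add: Suc)
qed simp

fun block_site :: "site \<Rightarrow> bool \<Rightarrow> nat \<Rightarrow> site" where
  "block_site (x, y) b j = (if b then x - int j else x + int j, y)"

text \<open>Contribution of the \<open>j\<close>-th site of the row, counted from the entry in the
  direction of the run. Sites \<open>j < k\<close> are left once; sites \<open>k\<close> and
  \<open>Suc k\<close> exchange the bounces. With flag \<open>False\<close> the walk leaves the row
  at \<open>k\<close> and the trap is \<open>Suc k\<close>, which for \<open>n = 0\<close> is not
  visited and gives factor 1. With flag \<open>True\<close> the trap is \<open>k\<close>, and its
  extra power is the last step of the leftward run.\<close>

fun site_factor :: "block \<Rightarrow> nat \<Rightarrow> site pmf \<Rightarrow> real" where
  "site_factor (False, k, n) j \<gamma> =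
     (if j < k then pmf \<gamma> e1 else if j = k then pmf \<gamma> e1 ^ n * pmf \<gamma> e2 else pmf \<gamma> (- e1) ^ n)"
| "site_factor (True, k, n) j \<gamma> =
     (if j < k then pmf \<gamma> (- e1) else if j = k then pmf \<gamma> (- e1) ^ Suc n else pmf \<gamma> e1 ^ n * pmf \<gamma> e2)"

lemma site_factor_nonneg: "0 \<le> site_factor B j \<gamma>"
  by (cases "(B, j, \<gamma>)" rule: site_factor.cases) auto

text \<open>Steps are regrouped by the site they leave: distinct sites are independent and can be
  averaged separately, repeated departures from one site cannot.\<close>

lemma path_weight_word:
  "path_weight \<omega> s (word B) =
    (\<Prod>j\<le>Suc (fst (snd B)). site_factor B j (\<omega> (block_site s (fst B) j)))"
proof -
  obtain b k n x y where B: "B = (b, k, n)" and s: "s = (x, y)"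
    by (cases B; cases s) auto
  have *: "path_weight \<omega> (x, y) [e2] = pmf (\<omega> (x, y)) e2" for x y by simp
  have prod: "(\<Prod>j\<le>Suc k. h j) = (\<Prod>j<k. h j) * h k * h (Suc k)" for h :: "nat \<Rightarrow> real"
    by (simp add: lessThan_Suc_atMost[symmetric])
  show ?thesis
  proof (cases b)
    case True
    have 1: "(x, y) + (- int (Suc k), 0) = (x - int k - 1, y)" by simp
    have 2: "x - int k - 1 + 1 = x - int k" by simp
    show ?thesis
      unfolding B s fst_conv snd_conv prod
      by (simp add: True path_weight_append sum_list_replicate_e1 sum_list_bounces path_weight_replicate
           path_weight_bounces power_mult_distrib * 1 2 del: replicate_Suc)
        (simp add: algebra_simps)
  next
    case False
    show ?thesis
      unfolding B s fst_conv snd_conv prod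
      by (simp add: False path_weight_append sum_list_replicate_e1 sum_list_bounces path_weight_replicate
           path_weight_bounces power_mult_distrib *)
        (simp add: algebra_simps)
  qed
qed

lemma path_weight_words:
  "path_weight \<omega> (x, y) (words Bs) =
    (\<Prod>r<length Bs. path_weight \<omega> (x + (\<Sum>i<r. disp (Bs ! i)), y + int r) (word (Bs ! r)))"
proof (induction Bs arbitrary: x y)
  case (Cons B Bs)
  then show ?case
    by (simp add: path_weight_append sum_list_word prod.lessThan_Suc_shift sum.lessThan_Suc_shift add.assoc
         del: word.simps prod.lessThan_Suc sum.lessThan_Suc)
qed simp

section \<open>Annealed mass of cylinders\<close>

lemma nn_integral_PiM_prod:
  assumes M: "\<And>i. prob_space (M i)" and F: "finite F"
    and g[measurable]: "\<And>i. i \<in> F \<Longrightarrow> g i \<in> borel_measurable (M i)"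
  shows "(\<integral>\<^sup>+\<omega>. (\<Prod>i\<in>F. g i (\<omega> i)) \<partial>(\<Pi>\<^sub>M i\<in>UNIV. M i)) = (\<Prod>i\<in>F. \<integral>\<^sup>+x. g i x \<partial>M i)"
proof -
  interpret prob_space "M i" for i by (rule M)
  interpret product_prob_space M UNIV
    by unfold_locales
  have "(\<Prod>i\<in>F. \<integral>\<^sup>+x. g i x \<partial>M i) = (\<integral>\<^sup>+\<omega>. (\<Prod>i\<in>F. g i (\<omega> i)) \<partial>(\<Pi>\<^sub>M i\<in>F. M i))"
    by (subst product_nn_integral_prod) (use F in auto)
  \<comment> \<open>Only the coordinates in \<open>F\<close> enter the integrand, so the infinite
    product may be projected onto the finite one, where the integral factors.\<close>
  also have "(\<Pi>\<^sub>M i\<in>F. M i) = distr (\<Pi>\<^sub>M i\<in>UNIV. M i) (\<Pi>\<^sub>M i\<in>F. M i) (\<lambda>x. restrict x F)"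
    by (rule distr_PiM_restrict_finite[symmetric]) (use F in auto)
  also have "integral\<^sup>N \<dots> (\<lambda>\<omega>. \<Prod>i\<in>F. g i (\<omega> i)) = (\<integral>\<^sup>+\<omega>. (\<Prod>i\<in>F. g i (\<omega> i)) \<partial>(\<Pi>\<^sub>M i\<in>UNIV. M i))"
    by (subst nn_integral_distr) (auto intro!: measurable_restrict_subset nn_integral_cong prod.cong)
  finally show ?thesis ..
qed

lemma emeasure_annealed:
  assumes "A \<in> sets path_space"
  shows "emeasure (annealed \<mu>) A = (\<integral>\<^sup>+\<omega>. emeasure (quenched \<omega>) A \<partial>env_law \<mu>)"
proof -
  have "space (env_law \<mu>) \<noteq> {}"
    by (simp add: env_law_def space_PiM)
  then show ?thesis
    unfolding annealed_def
    by (intro emeasure_bind[OF _ measurable_prob_algebraD[OF measurable_quenched] assms])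
qed

definition cyl :: "site list \<Rightarrow> path set" where
  "cyl l = {X. \<forall>i\<le>length l. X i = sum_list (take i l)}"

text \<open>The coordinate measures are arbitrary discrete ones, so that this serves both paths and
  block sequences.\<close>

lemma measurable_map_upt:
  fixes N :: "nat \<Rightarrow> 'a::countable measure"
  assumes N: "\<And>i. sets (N i) = UNIV"
  shows "(\<lambda>X. map X [0..<n]) \<in> (\<Pi>\<^sub>M i\<in>UNIV. N i) \<rightarrow>\<^sub>M count_space UNIV"
  unfolding measurable_count_space_eq2_countable
proof (intro conjI ballI)
  fix l :: "'a list"
  have "{X \<in> space (PiM UNIV N). \<forall>i\<in>{..<n}. X i = l ! i} \<in> sets (PiM UNIV N)"
  proof (intro sets.sets_Collect_finite_All)
    fix i
    have "(\<lambda>X. X i) -` {l ! i} \<inter> space (PiM UNIV N) \<in> sets (PiM UNIV N)"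
      by (rule measurable_sets[OF measurable_component_singleton]) (auto simp: N)
    also have "(\<lambda>X. X i) -` {l ! i} \<inter> space (PiM UNIV N) = {X \<in> space (PiM UNIV N). X i = l ! i}"
      by auto
    finally show "{X \<in> space (PiM UNIV N). X i = l ! i} \<in> sets (PiM UNIV N)" .
  qed simp
  moreover have "map X [0..<n] = l \<longleftrightarrow> length l = n \<and> (\<forall>i<n. X i = l ! i)" for X
    by (subst list_eq_iff_nth_eq) auto
  then have "(\<lambda>X. map X [0..<n]) -` {l} \<inter> space (PiM UNIV N) =
      (if length l = n then {X \<in> space (PiM UNIV N). \<forall>i\<in>{..<n}. X i = l ! i} else {})"
    by auto
  ultimately show "(\<lambda>X. map X [0..<n]) -` {l} \<inter> space (PiM UNIV N) \<in> sets (PiM UNIV N)"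
    by simp
qed simp

text \<open>Such a set is the preimage of a set of finite lists of sites, and there are only
  countably many of these lists.\<close>

lemma sets_coordinates:
  assumes "\<And>X Y. (\<And>i. i \<le> n \<Longrightarrow> X i = Y i) \<Longrightarrow> X \<in> A \<Longrightarrow> Y \<in> A"
  shows "A \<in> sets path_space"
proof -
  let ?f = "\<lambda>X. map X [0..<Suc n]"
  have "?f -` (?f ` A) \<inter> space path_space \<in> sets path_space"
    unfolding path_space_def by (rule measurable_sets[OF measurable_map_upt]) auto
  also have "?f -` (?f ` A) \<inter> space path_space = A"
  proof (intro set_eqI iffI)
    fix X assume "X \<in> ?f -` (?f ` A) \<inter> space path_space"
    then obtain Y where "Y \<in> A" "\<forall>i\<le>n. X i = Y i"
      by (auto simp: less_Suc_eq_le simp del: upt_Suc)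
    then show "X \<in> A" using assms[of Y X] by auto
  qed (auto simp: path_space_def space_PiM simp del: upt_Suc)
  finally show ?thesis .
qed

lemma sets_cyl: "cyl l \<in> sets path_space"
  by (rule sets_coordinates[of "length l"]) (auto simp: cyl_def)

lemma emeasure_annealed_cyl:
  "emeasure (annealed \<mu>) (cyl l) = (\<integral>\<^sup>+\<omega>. ennreal (path_weight \<omega> 0 l) \<partial>env_law \<mu>)"
proof -
  have "emeasure (quenched \<omega>) (cyl l) = ennreal (path_weight \<omega> 0 l)" for \<omega>
    unfolding cyl_def emeasure_quenched_cylinder
    by (simp add: path_weight_eq_prod take_Suc_conv_app_nth)
  then show ?thesis
    by (subst emeasure_annealed[OF sets_cyl]) simp
qed

lemma emeasure_annealed_cyl_words:
  "emeasure (annealed \<mu>) (cyl (words Bs)) =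
     (\<Prod>r<length Bs. \<Prod>j\<le>Suc (fst (snd (Bs ! r))). \<integral>\<^sup>+\<gamma>. ennreal (site_factor (Bs ! r) j \<gamma>) \<partial>\<mu>)"
proof -
  define I where "I = (SIGMA r:{..<length Bs}. {..Suc (fst (snd (Bs ! r)))})"
  define f where "f z = block_site (\<Sum>i<fst z. disp (Bs ! i), int (fst z)) (fst (Bs ! fst z)) (snd z)" for z
  define g where "g z \<gamma> = site_factor (Bs ! fst z) (snd z) \<gamma>" for z \<gamma>
  \<comment> \<open>Different blocks use different rows, and within a row the offset runs in the one
    direction fixed by the flag, so no lattice site is listed twice.\<close>
  have inj: "inj_on f I"
    by (rule inj_onI) (auto simp: f_def prod_eq_iff split: if_splits)
  have fin: "finite I" by (simp add: I_def)
  \<comment> \<open>Indexing the product by lattice sites instead of pairs (row, offset) gives one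
    factor for each coordinate of \<open>\<omega>\<close>, the form in which independence
    applies.\<close>
  have "path_weight \<omega> 0 (words Bs) = (\<Prod>x\<in>f ` I. g (inv_into I f x) (\<omega> x))" for \<omega>
  proof -
    have "path_weight \<omega> 0 (words Bs) = (\<Prod>z\<in>I. g z (\<omega> (f z)))"
      unfolding I_def g_def f_def
      by (simp add: zero_prod_def path_weight_words path_weight_word prod.Sigma split_beta
          del: word.simps block_site.simps prod.atMost_Suc)
    then show ?thesis
      by (simp add: prod.reindex[OF inj] inv_into_f_f[OF inj])
  qed
  then have "emeasure (annealed \<mu>) (cyl (words Bs)) =
      (\<integral>\<^sup>+\<omega>. (\<Prod>x\<in>f ` I. ennreal (g (inv_into I f x) (\<omega> x))) \<partial>env_law \<mu>)"
    by (simp add: emeasure_annealed_cyl prod_ennreal g_def site_factor_nonneg)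
  also have "\<dots> = (\<Prod>x\<in>f ` I. \<integral>\<^sup>+\<gamma>. ennreal (g (inv_into I f x) \<gamma>) \<partial>\<mu>)"
    unfolding env_law_def
    by (rule nn_integral_PiM_prod) (auto simp: fin prob_space_measure_pmf)
  also have "\<dots> = (\<Prod>z\<in>I. \<integral>\<^sup>+\<gamma>. ennreal (g z \<gamma>) \<partial>\<mu>)"
    by (simp add: prod.reindex[OF inj] inv_into_f_f[OF inj])
  finally show ?thesis
    by (simp add: I_def g_def prod.Sigma split_beta del: prod.atMost_Suc)
qed

section \<open>The law of a block\<close>

lemma nn_integral_count_space_block:
  "(\<integral>\<^sup>+B. h B \<partial>count_space (UNIV :: block set)) = (\<Sum>k. \<Sum>n. h (True, k, n)) + (\<Sum>k. \<Sum>n. h (False, k, n))"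
proof -
  have "(\<integral>\<^sup>+B. h B \<partial>count_space (UNIV :: block set)) =
      (\<integral>\<^sup>+b. \<integral>\<^sup>+k. \<integral>\<^sup>+n. h (b, k, n) \<partial>count_space UNIV \<partial>count_space UNIV \<partial>count_space UNIV)"
    by (simp add: nn_integral_fst_count_space[symmetric])
  then show ?thesis
    by (simp add: nn_integral_count_space_nat nn_integral_count_space_finite UNIV_bool add.commute)
qed

section \<open>Double sums and moments of geometric series\<close>

lemma suminf_ennreal_product:
  fixes u w :: "nat \<Rightarrow> real"
  assumes "u sums U" "w sums W" "\<And>k. 0 \<le> u k" "\<And>n. 0 \<le> w n"
  shows "(\<Sum>k. \<Sum>n. ennreal (u k * w n)) = ennreal (U * W)"
proof -
  have "0 \<le> W" using assms sums_le[of "\<lambda>_. 0" w 0 W] by auto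
  have "(\<Sum>n. ennreal (u k * w n)) = ennreal (u k * W)" for k
    using assms by (intro suminf_ennreal_eq sums_mult) auto
  moreover have "(\<Sum>k. ennreal (u k * W)) = ennreal (U * W)"
    using assms \<open>0 \<le> W\<close> by (intro suminf_ennreal_eq sums_mult2) auto
  ultimately show ?thesis by simp
qed

lemma geometric_sums_linear:
  fixes r :: real
  assumes "0 \<le> r" "r < 1"
  shows "(\<lambda>n. r ^ n * real n) sums (r / (1 - r)\<^sup>2)" "(\<lambda>n. r ^ Suc n * real (Suc n)) sums (r / (1 - r)\<^sup>2)"
proof -
  have "(\<lambda>n. r * (of_nat (Suc n) * r ^ n)) sums (r * (1 / (1 - r)\<^sup>2))"
    by (intro sums_mult geometric_deriv_sums) (use assms in simp)
  then show *: "(\<lambda>n. r ^ Suc n * real (Suc n)) sums (r / (1 - r)\<^sup>2)"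
    by (simp add: ac_simps)
  then show "(\<lambda>n. r ^ n * real n) sums (r / (1 - r)\<^sup>2)"
    by (subst (asm) sums_Suc_iff) simp
qed

text \<open>Comparison with the twice differentiated geometric series, whose coefficients are
  \<open>(n + 1) * (n + 2)\<close>. It supplies the second moments that the strong law asks
  for.\<close>

lemma summable_geometric_quadratic:
  fixes r :: real
  assumes "0 \<le> r" "r < 1"
  shows "summable (\<lambda>n. r ^ n * (2 * real n + 1)\<^sup>2)"
proof (rule summable_comparison_test')
  have 1: "summable (\<lambda>n. diffs (\<lambda>_. 1) n * x ^ n)" if "norm x < 1" for x :: real
    using that by (intro termdiff_converges[where K = 1]) (auto intro: summable_geometric)
  have "summable (\<lambda>n. diffs (diffs (\<lambda>_. 1)) n * r ^ n)"
    using assms by (intro termdiff_converges[where K = 1] 1) auto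
  then show "summable (\<lambda>n. 4 * (diffs (diffs (\<lambda>_. 1)) n * r ^ n))"
    by (rule summable_mult)
  show "norm (r ^ n * (2 * real n + 1)\<^sup>2) \<le> 4 * (diffs (diffs (\<lambda>_. 1)) n * r ^ n)" for n
  proof -
    have "(2 * real n + 1)\<^sup>2 \<le> 4 * (real (Suc n) * real (Suc (Suc n)))"
      by (simp add: power2_eq_square algebra_simps)
    then have "r ^ n * (2 * real n + 1)\<^sup>2 \<le> r ^ n * (4 * (real (Suc n) * real (Suc (Suc n))))"
      by (rule mult_left_mono) (use assms in simp)
    then show ?thesis using assms by (simp add: diffs_def ac_simps)
  qed
qed

section \<open>Averages over the type of one site\<close>

lemma pmf_right_up:
  assumes "0 \<le> r" "r \<le> 1"
  shows "pmf (right_up r) e1 = r" "pmf (right_up r) e2 = 1 - r" "pmf (right_up r) (- e1) = 0"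
  using assms step_neq by (auto simp: right_up_def map_pmf_def pmf_bind)

lemma pmf_gamma3: "pmf gamma3 e1 = 0" "pmf gamma3 e2 = 0" "pmf gamma3 (- e1) = 1"
  using step_neq by (auto simp: gamma3_def)

lemma nn_integral_site_law:
  assumes "0 \<le> p" "p \<le> 1" "0 \<le> q" "q \<le> 1" "\<And>\<gamma>. 0 \<le> f \<gamma>"
  shows "(\<integral>\<^sup>+\<gamma>. ennreal (f \<gamma>) \<partial>site_law \<alpha> \<beta> p q) =
    ennreal (p * f gamma3 + (1 - p) * (q * f (right_up \<alpha>) + (1 - q) * f (right_up \<beta>)))"
  using assms unfolding site_law_def
  by (simp add: nn_integral_bind_pmf nn_integral_bernoulli_pmf ennreal_mult'[symmetric] ennreal_plus[symmetric]
      ac_simps del: ennreal_plus)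

section \<open>Block weights and sums against them\<close>

locale three_valued_walk =
  fixes \<alpha> \<beta> p q :: real
  assumes \<alpha>: "0 < \<alpha>" "\<alpha> < 1" and \<beta>: "0 < \<beta>" "\<beta> < 1" and p: "0 < p" "p < 1" and q: "0 \<le> q" "q \<le> 1"
begin

definition \<eta> :: real where "\<eta> = q * \<alpha> + (1 - q) * \<beta>"
definition a :: real where "a = (1 - p) * \<eta>"
definition \<xi> :: real where "\<xi> = q * \<alpha> / (1 - \<alpha>) + (1 - q) * \<beta> / (1 - \<beta>)"

text \<open>The site-law mean of \<open>pmf \<gamma> e1 ^ n * pmf \<gamma> e2\<close>: one and the
  same site is left \<open>n\<close> times to the right and once upwards. A trap contributes
  zero.\<close>

definition bounce_weight :: "nat \<Rightarrow> real" where
  "bounce_weight n = (1 - p) * (q * (\<alpha> ^ n * (1 - \<alpha>)) + (1 - q) * (\<beta> ^ n * (1 - \<beta>)))"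

text \<open>After a rightward run the type of the next site matters only if the walk bounces off it;
  hence the factor 1 for \<open>n = 0\<close> and \<open>p\<close> otherwise. After a leftward run
  the neighbouring trap is already paid for by \<open>p ^ Suc k\<close>.\<close>

fun block_weight :: "block \<Rightarrow> real" where
  "block_weight (b, k, n) = (if b then p ^ Suc k else a ^ k * (if n = 0 then 1 else p)) * bounce_weight n"

lemma \<eta>_bounds: "0 < \<eta>" "\<eta> < 1"
proof -
  show "0 < \<eta>"
    unfolding \<eta>_def using \<alpha> \<beta> q by (cases "q = 0") (auto intro!: add_pos_nonneg)
  have "q * \<alpha> + (1 - q) * \<beta> < q * 1 + (1 - q) * 1"
  proof (cases "q = 0")
    case False
    then show ?thesis using \<alpha> \<beta> q by (intro add_less_le_mono mult_strict_left_mono mult_left_mono) auto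
  qed (use \<beta> in simp)
  then show "\<eta> < 1" by (simp add: \<eta>_def)
qed

lemma a_bounds: "0 < a" "a < 1"
proof -
  show "0 < a" using \<eta>_bounds p by (simp add: a_def)
  have "(1 - p) * \<eta> < 1 * 1" using \<eta>_bounds p by (intro mult_strict_mono) auto
  then show "a < 1" by (simp add: a_def)
qed

lemma \<xi>_nonneg: "0 \<le> \<xi>"
  using \<alpha> \<beta> q by (auto simp: \<xi>_def)

lemma bounce_weight_nonneg: "0 \<le> bounce_weight n"
  using \<alpha> \<beta> p q by (auto simp: bounce_weight_def intro!: mult_nonneg_nonneg add_nonneg_nonneg)

lemma block_weight_nonneg: "0 \<le> block_weight B"
  using a_bounds p bounce_weight_nonneg by (cases B) auto

lemma prod_site_factor_means:
  "(\<Prod>j\<le>Suc (fst (snd B)). \<integral>\<^sup>+\<gamma>. ennreal (site_factor B j \<gamma>) \<partial>site_law \<alpha> \<beta> p q) = ennreal (block_weight B)"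
proof -
  obtain b k n where B: "B = (b, k, n)" by (cases B)
  define m where "m j = p * site_factor B j gamma3 +
    (1 - p) * (q * site_factor B j (right_up \<alpha>) + (1 - q) * site_factor B j (right_up \<beta>))" for j
  have m_nonneg: "0 \<le> m j" for j
    using p q site_factor_nonneg by (auto simp: m_def intro!: mult_nonneg_nonneg add_nonneg_nonneg)
  have "(\<Prod>j\<le>Suc k. m j) = (\<Prod>j<k. m j) * m k * m (Suc k)"
    by (simp add: lessThan_Suc_atMost[symmetric])
  also have "(\<Prod>j<k. m j) = (\<Prod>j<k. if b then p else a)"
    using \<alpha> \<beta> by (intro prod.cong refl)
      (cases b; simp add: m_def B pmf_right_up pmf_gamma3 a_def \<eta>_def)
  \<comment> \<open>The case \<open>n = 0\<close> is separate because \<open>0 ^ 0 = 1\<close>: a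
    non-trap beyond the turning point then has factor 1 instead of 0.\<close>
  also have "(\<Prod>j<k. if b then p else a) * m k * m (Suc k) = block_weight B"
    using \<alpha> \<beta>
    by (cases b; cases "n = 0")
      (simp_all add: m_def B pmf_right_up pmf_gamma3 bounce_weight_def power_0_left algebra_simps)
  finally have "(\<Prod>j\<le>Suc k. m j) = block_weight B" .
  then show ?thesis
    using p q by (simp only: B fst_conv snd_conv nn_integral_site_law[OF _ _ _ _ site_factor_nonneg] less_imp_le
       m_def[symmetric, unfolded B] prod_ennreal m_nonneg)
qed

text \<open>Apart from the exception at \<open>n = 0\<close>, the weight is a function of
  \<open>k\<close> times a function of \<open>n\<close>. For integrands of the same product form
  everything reduces to single series, and this one formula yields the total mass, the means and the
  second moments.\<close>

lemma nn_integral_block_weight: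
  assumes w: "(\<lambda>n. bounce_weight n * w n) sums W" "\<And>n. 0 \<le> w n"
    and u: "(\<lambda>k. p ^ Suc k * u True k) sums U" "(\<lambda>k. a ^ k * u False k) sums V" "\<And>b k. 0 \<le> u b k"
  shows "(\<integral>\<^sup>+B. ennreal (block_weight B) * ennreal (u (fst B) (fst (snd B)) * w (snd (snd B))) \<partial>count_space UNIV)
    = ennreal (U * W + V * (p * W + (1 - p) * (1 - p) * (1 - \<eta>) * w 0))"
proof -
  let ?w = "\<lambda>n. (if n = 0 then 1 else p) * bounce_weight n * w n"
  \<comment> \<open>Writing the factor at \<open>n = 0\<close> as \<open>1 = p + (1 - p)\<close>
    leaves a uniform factor \<open>p\<close> and one isolated term.\<close>
  have "(\<lambda>n. p * (bounce_weight n * w n) + (if n = 0 then (1 - p) * (bounce_weight 0 * w 0) else 0)) sums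
      (p * W + (1 - p) * (bounce_weight 0 * w 0))"
    by (intro sums_add sums_mult w sums_single)
  also have "(\<lambda>n. p * (bounce_weight n * w n) + (if n = 0 then (1 - p) * (bounce_weight 0 * w 0) else 0)) = ?w"
    by (auto simp: fun_eq_iff algebra_simps)
  also have "bounce_weight 0 = (1 - p) * (1 - \<eta>)"
    by (simp add: bounce_weight_def \<eta>_def algebra_simps)
  finally have w': "?w sums (p * W + (1 - p) * (1 - p) * (1 - \<eta>) * w 0)"
    by (simp add: ac_simps)
  have 2: "(\<Sum>k. \<Sum>n. ennreal ((a ^ k * u False k) * ?w n)) =
      ennreal (V * (p * W + (1 - p) * (1 - p) * (1 - \<eta>) * w 0))"
    using p a_bounds by (intro suminf_ennreal_product[OF u(2) w'] mult_nonneg_nonneg u(3) w(2) bounce_weight_nonneg) auto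
  have 1: "(\<Sum>k. \<Sum>n. ennreal ((p ^ Suc k * u True k) * (bounce_weight n * w n))) = ennreal (U * W)"
    using p by (intro suminf_ennreal_product[OF u(1) w(1)] mult_nonneg_nonneg u(3) w(2) bounce_weight_nonneg) auto
  have "(\<integral>\<^sup>+B. ennreal (block_weight B) * ennreal (u (fst B) (fst (snd B)) * w (snd (snd B))) \<partial>count_space UNIV) =
     (\<Sum>k. \<Sum>n. ennreal ((p ^ Suc k * u True k) * (bounce_weight n * w n)))
     + (\<Sum>k. \<Sum>n. ennreal ((a ^ k * u False k) * ?w n))"
    unfolding nn_integral_count_space_block ennreal_mult[OF block_weight_nonneg mult_nonneg_nonneg[OF u(3) w(2)], symmetric]
    by (intro arg_cong2[where f = "(+)"] suminf_cong; simp add: ac_simps)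
  also have "\<dots> = ennreal (U * W) + ennreal (V * (p * W + (1 - p) * (1 - p) * (1 - \<eta>) * w 0))"
    by (simp only: 1 2)
  also have "\<dots> = ennreal (U * W + V * (p * W + (1 - p) * (1 - p) * (1 - \<eta>) * w 0))"
  proof -
    have "0 \<le> U" "0 \<le> V" "0 \<le> W"
      using p a_bounds
      by (auto intro!: sums_le[OF _ sums_zero u(1)] sums_le[OF _ sums_zero u(2)] sums_le[OF _ sums_zero w(1)]
          mult_nonneg_nonneg u(3) w(2) bounce_weight_nonneg)
    then show ?thesis
      using p \<eta>_bounds w(2) by (intro ennreal_plus[symmetric]) auto
  qed
  finally show ?thesis .
qed

lemma sums_bounce_weight:
  assumes "(\<lambda>n. \<alpha> ^ n * w n) sums A" "(\<lambda>n. \<beta> ^ n * w n) sums B"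
  shows "(\<lambda>n. bounce_weight n * w n) sums ((1 - p) * (q * (1 - \<alpha>) * A + (1 - q) * (1 - \<beta>) * B))"
proof -
  have "(\<lambda>n. (1 - p) * (q * (1 - \<alpha>) * (\<alpha> ^ n * w n) + (1 - q) * (1 - \<beta>) * (\<beta> ^ n * w n))) sums
      ((1 - p) * (q * (1 - \<alpha>) * A + (1 - q) * (1 - \<beta>) * B))"
    by (intro sums_mult sums_add assms)
  then show ?thesis by (simp add: bounce_weight_def algebra_simps)
qed

lemma sums_bounce_weight_1: "(\<lambda>n. bounce_weight n * 1) sums (1 - p)"
proof -
  have "(\<lambda>n. \<alpha> ^ n * 1) sums (1 / (1 - \<alpha>))" "(\<lambda>n. \<beta> ^ n * 1) sums (1 / (1 - \<beta>))"
    using \<alpha> \<beta> geometric_sums[of \<alpha>] geometric_sums[of \<beta>] by auto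
  from sums_bounce_weight[OF this] show ?thesis
    using \<alpha> \<beta> by simp
qed

text \<open>\<open>2 * n + 1\<close> counts the bounce steps and the closing upward step. One factor
  \<open>1 - r\<close> cancels against the squared denominator, and the remaining geometric means
  \<open>r / (1 - r)\<close> combine to \<open>\<xi>\<close>.\<close>

lemma sums_bounce_weight_dur: "(\<lambda>n. bounce_weight n * (2 * real n + 1)) sums ((1 - p) * (1 + 2 * \<xi>))"
proof -
  have geom: "(\<lambda>n. r ^ n * (2 * real n + 1)) sums (2 * (r / (1 - r)\<^sup>2) + 1 / (1 - r))" if "0 < r" "r < 1" for r :: real
  proof -
    have "(\<lambda>n. 2 * (r ^ n * real n) + r ^ n) sums (2 * (r / (1 - r)\<^sup>2) + 1 / (1 - r))"
      using that by (intro sums_add sums_mult geometric_sums_linear geometric_sums) auto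
    then show ?thesis by (simp add: algebra_simps)
  qed
  have eq: "c * (1 - r) * (2 * (r / (1 - r)\<^sup>2) + 1 / (1 - r)) = 2 * (c * r / (1 - r)) + c" if "r < 1" for c r :: real
  proof -
    have "(1 - r) * (r / (1 - r)\<^sup>2) = r / (1 - r)" "(1 - r) * (1 / (1 - r)) = 1"
      using that by (simp_all add: power2_eq_square)
    then have "c * (1 - r) * (2 * (r / (1 - r)\<^sup>2) + 1 / (1 - r)) = c * (2 * (r / (1 - r)) + 1)"
      by (simp only: distrib_left mult.assoc mult.left_commute[of 2] mult.left_commute[of "1 - r" 2])
    then show ?thesis by (simp add: algebra_simps)
  qed
  from sums_bounce_weight[OF geom[OF \<alpha>] geom[OF \<beta>]]
  have "(\<lambda>n. bounce_weight n * (2 * real n + 1)) sums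
     ((1 - p) * (q * (1 - \<alpha>) * (2 * (\<alpha> / (1 - \<alpha>)\<^sup>2) + 1 / (1 - \<alpha>))
      + (1 - q) * (1 - \<beta>) * (2 * (\<beta> / (1 - \<beta>)\<^sup>2) + 1 / (1 - \<beta>))))" .
  also have "\<dots> = (1 - p) * (1 + 2 * \<xi>)"
    unfolding eq[OF \<alpha>(2)] eq[OF \<beta>(2)] \<xi>_def by (simp add: algebra_simps)
  finally show ?thesis .
qed

end

section \<open>The walk as a concatenation of independent words\<close>

lemma indep_vars_PiM_components:
  fixes M :: "'i \<Rightarrow> 'a measure"
  assumes M: "\<And>i. prob_space (M i)"
  shows "prob_space.indep_vars (\<Pi>\<^sub>M i\<in>UNIV. M i) M (\<lambda>i x. x i) UNIV"
proof -
  interpret prob_space "\<Pi>\<^sub>M i\<in>UNIV. M i" by (intro prob_space_PiM M)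
  have "distr (\<Pi>\<^sub>M i\<in>UNIV. M i) (\<Pi>\<^sub>M i\<in>UNIV. M i) (\<lambda>x. \<lambda>i\<in>UNIV. x i) = (\<Pi>\<^sub>M i\<in>UNIV. M i)"
    by (simp add: restrict_UNIV distr_id)
  also have "\<dots> = (\<Pi>\<^sub>M i\<in>UNIV. distr (\<Pi>\<^sub>M i\<in>UNIV. M i) (M i) (\<lambda>x. x i))"
    by (intro PiM_cong refl distr_PiM_component[symmetric] M) auto
  finally show ?thesis
    by (subst indep_vars_iff_distr_eq_PiM) auto
qed

lemma strong_law_pmf_nonneg:
  fixes f :: "'a \<Rightarrow> real"
  assumes nonneg: "\<And>x. 0 \<le> f x" and sq: "integrable (measure_pmf \<nu>) (\<lambda>x. (f x)\<^sup>2)"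
  shows "AE w in (\<Pi>\<^sub>M i\<in>UNIV. measure_pmf \<nu>).
    (\<lambda>n. (\<Sum>i<n. f (w i)) / real n) \<longlonglongrightarrow> measure_pmf.expectation \<nu> f"
proof -
  let ?M = "\<Pi>\<^sub>M (i::nat)\<in>UNIV. measure_pmf \<nu>"
  interpret prob_space ?M by (intro prob_space_PiM prob_space_measure_pmf)
  have [measurable]: "(\<lambda>w. w i) \<in> ?M \<rightarrow>\<^sub>M measure_pmf \<nu>" for i :: nat
    by (rule measurable_component_singleton) simp
  have \<nu>: "measure_pmf \<nu> = distr ?M (measure_pmf \<nu>) (\<lambda>w. w i)" for i :: nat
    by (rule distr_PiM_component[symmetric]) (auto simp: prob_space_measure_pmf)
  have ex: "expectation (\<lambda>w. g (w i)) = measure_pmf.expectation \<nu> g" for g :: "'a \<Rightarrow> real" and i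
    by (subst \<nu>[of i]) (simp add: integral_distr)
  show ?thesis
  proof (rule strong_law_nonneg)
    show "indep_vars (\<lambda>_. borel) (\<lambda>i w. f (w i)) UNIV"
      by (rule indep_vars_compose2[OF indep_vars_PiM_components]) (auto simp: prob_space_measure_pmf)
    show "integrable ?M (\<lambda>w. (f (w i))\<^sup>2)" for i
      using sq by (subst (asm) \<nu>[of i]) (simp add: integrable_distr_eq)
    show "expectation (\<lambda>w. f (w i)) = measure_pmf.expectation \<nu> f" for i
      by (rule ex)
    show "variance (\<lambda>w. f (w i)) \<le> measure_pmf.variance \<nu> f" for i
      by (simp add: ex ex[of "\<lambda>x. (f x - measure_pmf.expectation \<nu> f)\<^sup>2"])
  qed (rule nonneg)
qed

lemma measurable_block_walk:
  "block_walk \<in> (\<Pi>\<^sub>M i\<in>UNIV. measure_pmf \<nu>) \<rightarrow>\<^sub>M path_space"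
  unfolding path_space_def
proof (rule measurable_PiM_single')
  fix n
  have "(\<lambda>w. map w [0..<n]) \<in> (\<Pi>\<^sub>M i\<in>UNIV. measure_pmf \<nu>) \<rightarrow>\<^sub>M count_space UNIV"
    by (rule measurable_map_upt) simp
  then show "(\<lambda>w. block_walk w n) \<in> (\<Pi>\<^sub>M i\<in>UNIV. measure_pmf \<nu>) \<rightarrow>\<^sub>M count_space UNIV"
    unfolding block_walk_def by (rule measurable_compose) simp
qed (simp add: space_PiM)

lemma emeasure_PiM_pmf_prefix:
  "emeasure (\<Pi>\<^sub>M i\<in>UNIV. measure_pmf \<nu>) {w. \<forall>i<length xs. w i = xs ! i} = (\<Prod>i<length xs. ennreal (pmf \<nu> (xs ! i)))"
proof -
  interpret product_prob_space "\<lambda>_::nat. measure_pmf \<nu>" UNIV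
    by unfold_locales
  have "emeasure (\<Pi>\<^sub>M i\<in>UNIV. measure_pmf \<nu>)
      {w \<in> space (\<Pi>\<^sub>M i\<in>UNIV. measure_pmf \<nu>). \<forall>i\<in>{..<length xs}. w i \<in> {xs ! i}} =
      (\<Prod>i<length xs. emeasure (measure_pmf \<nu>) {xs ! i})"
    by (rule emeasure_PiM_Collect) auto
  then show ?thesis
    by (simp add: space_PiM emeasure_pmf_single Ball_def)
qed

text \<open>Both measures give the same mass to every word cylinder of \<open>n\<close> blocks, and those blocks fix
  the walk up to time \<open>n\<close>; the word cylinders inside \<open>A\<close> are disjoint, and under the block measure
  they exhaust \<open>A\<close>.\<close>

lemma emeasure_block_walk_le:
  assumes coord: "\<And>X Y. (\<And>i. i \<le> n \<Longrightarrow> X i = Y i) \<Longrightarrow> X \<in> A \<Longrightarrow> Y \<in> A"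
    and cyl: "\<And>Bs. emeasure P (cyl (words Bs)) = (\<Prod>r<length Bs. ennreal (pmf \<nu> (Bs ! r)))"
    and P: "sets P = sets path_space"
  shows "emeasure (distr (\<Pi>\<^sub>M i\<in>UNIV. measure_pmf \<nu>) path_space block_walk) A \<le> emeasure P A"
proof -
  let ?M = "\<Pi>\<^sub>M (i::nat)\<in>UNIV. measure_pmf \<nu>"
  define G where "G = {Bs. length Bs = n \<and> (\<lambda>i. sum_list (take i (words Bs))) \<in> A}"
  have A: "A \<in> sets path_space" by (rule sets_coordinates) (rule coord)
  have len: "n \<le> length (words Bs)" if "Bs \<in> G" for Bs
    using length_le_words[of Bs] that by (simp add: G_def)
  have space: "space ?M = UNIV" by (simp add: space_PiM)
  have sets: "{w. \<forall>i<length Bs. w i = Bs ! i} \<in> sets ?M" for Bs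
  proof -
    have "(\<lambda>w. map w [0..<length Bs]) -` {Bs} \<inter> space ?M \<in> sets ?M"
      by (rule measurable_sets[OF measurable_map_upt]) auto
    also have "(\<lambda>w. map w [0..<length Bs]) -` {Bs} \<inter> space ?M = {w. \<forall>i<length Bs. w i = Bs ! i}"
    proof -
      have "map w [0..<length Bs] = Bs \<longleftrightarrow> (\<forall>i<length Bs. w i = Bs ! i)" for w
        by (subst list_eq_iff_nth_eq) auto
      then show ?thesis by (auto simp: space)
    qed
    finally show ?thesis .
  qed
  have "block_walk w \<in> A \<longleftrightarrow> map w [0..<n] \<in> G" for w
  proof -
    have eq: "block_walk w i = sum_list (take i (words (map w [0..<n])))" if "i \<le> n" for i
      using that length_le_words[of "map w [0..<n]"] by (intro block_walk_eq) simp
    have "block_walk w \<in> A \<longleftrightarrow> (\<lambda>i. sum_list (take i (words (map w [0..<n])))) \<in> A"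
      by (rule iffI; erule coord[rotated]; simp add: eq)
    then show ?thesis by (simp add: G_def)
  qed
  moreover have "map w [0..<n] \<in> G \<longleftrightarrow> (\<exists>Bs\<in>G. \<forall>i<length Bs. w i = Bs ! i)" for w
  proof -
    have "map w [0..<n] = Bs \<longleftrightarrow> (\<forall>i<length Bs. w i = Bs ! i)" if "Bs \<in> G" for Bs
      using that by (subst list_eq_iff_nth_eq) (auto simp: G_def)
    then show ?thesis by (metis (no_types, lifting))
  qed
  ultimately have "block_walk -` A \<inter> space ?M = (\<Union>Bs\<in>G. {w. \<forall>i<length Bs. w i = Bs ! i})"
    by (auto simp: space)
  then have "emeasure (distr ?M path_space block_walk) A = emeasure ?M (\<Union>Bs\<in>G. {w. \<forall>i<length Bs. w i = Bs ! i})"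
    by (simp add: emeasure_distr[OF measurable_block_walk A])
  also have "\<dots> = (\<integral>\<^sup>+Bs. emeasure ?M {w. \<forall>i<length Bs. w i = Bs ! i} \<partial>count_space G)"
  proof (rule emeasure_UN_countable)
    show "disjoint_family_on (\<lambda>Bs. {w. \<forall>i<length Bs. w i = Bs ! i}) G"
      by (auto simp: disjoint_family_on_def G_def intro!: nth_equalityI)
  qed (auto simp: sets)
  also have "\<dots> = (\<integral>\<^sup>+Bs. emeasure P (cyl (words Bs)) \<partial>count_space G)"
    by (simp only: emeasure_PiM_pmf_prefix cyl)
  also have "\<dots> = emeasure P (\<Union>Bs\<in>G. cyl (words Bs))"
  proof (rule emeasure_UN_countable[symmetric])
    show "disjoint_family_on (\<lambda>Bs. cyl (words Bs)) G"
      unfolding disjoint_family_on_def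
    proof (intro ballI impI equals0I)
      fix Bs Cs X assume *: "Bs \<in> G" "Cs \<in> G" "Bs \<noteq> Cs" "X \<in> cyl (words Bs) \<inter> cyl (words Cs)"
      have "X (Suc i) - X i = l ! i" if "X \<in> cyl l" "i < length l" for i l
        using that by (simp add: cyl_def take_Suc_conv_app_nth)
      then have "Bs = Cs"
        using * by (intro words_prefix_unique[of _ "\<lambda>i. X (Suc i) - X i"]) (auto simp: G_def)
      with * show False by simp
    qed
  qed (auto simp: P sets_cyl)
  also have "\<dots> \<le> emeasure P A"
  proof (rule emeasure_mono)
    show "(\<Union>Bs\<in>G. cyl (words Bs)) \<subseteq> A"
    proof safe
      fix Bs X assume *: "Bs \<in> G" "X \<in> cyl (words Bs)"
      show "X \<in> A"
        by (rule coord[of "\<lambda>i. sum_list (take i (words Bs))"]) (use * len[of Bs] in \<open>auto simp: cyl_def G_def\<close>)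
    qed
  qed (simp add: P A)
  finally show ?thesis .
qed

text \<open>Both measures have mass 1, so a one-sided bound that holds for \<open>A\<close> and for
  its complement must be an equality. The events depending on finitely many times include the
  cylinders that determine a measure on path space.\<close>

lemma distr_block_walk_eq:
  assumes cyl: "\<And>Bs. emeasure P (cyl (words Bs)) = (\<Prod>r<length Bs. ennreal (pmf \<nu> (Bs ! r)))"
    and P: "sets P = sets path_space" "prob_space P"
  shows "distr (\<Pi>\<^sub>M i\<in>UNIV. measure_pmf \<nu>) path_space block_walk = P"
proof -
  let ?Q = "distr (\<Pi>\<^sub>M (i::nat)\<in>UNIV. measure_pmf \<nu>) path_space block_walk"
  interpret P: prob_space P by fact
  interpret M: prob_space "\<Pi>\<^sub>M (i::nat)\<in>UNIV. measure_pmf \<nu>"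
    by (intro prob_space_PiM prob_space_measure_pmf)
  interpret Q: prob_space ?Q
    by (rule M.prob_space_distr[OF measurable_block_walk])
  have space: "space P = UNIV" "space path_space = UNIV"
    using sets_eq_imp_space_eq[OF P(1)] by (auto simp: path_space_def space_PiM)
  have eq: "emeasure ?Q A = emeasure P A"
    if coord: "\<And>X Y. (\<And>i. i \<le> n \<Longrightarrow> X i = Y i) \<Longrightarrow> X \<in> A \<longleftrightarrow> Y \<in> A" for A n
  proof (rule antisym)
    show le: "emeasure ?Q A \<le> emeasure P A"
      by (rule emeasure_block_walk_le[OF _ cyl P(1), of n]) (use coord in blast)
    have le': "emeasure ?Q (- A) \<le> emeasure P (- A)"
      by (rule emeasure_block_walk_le[OF _ cyl P(1), of n]) (use coord in blast)
    have A: "A \<in> sets path_space"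
      by (rule sets_coordinates[of n]) (use coord in blast)
    have "prob_space.prob ?Q (- A) = 1 - Q.prob A" "P.prob (- A) = 1 - P.prob A"
      using Q.prob_compl[of A] P.prob_compl[of A] A P(1) space by (simp_all add: Compl_eq_Diff_UNIV)
    then show "emeasure P A \<le> emeasure ?Q A"
      using le' by (simp add: P.emeasure_eq_measure Q.emeasure_eq_measure)
  qed
  show ?thesis
  proof (rule measure_eqI_PiM_infinite)
    show "sets ?Q = sets (\<Pi>\<^sub>M i\<in>UNIV. count_space UNIV)" "sets P = sets (\<Pi>\<^sub>M i\<in>UNIV. count_space UNIV)"
      by (simp_all add: P path_space_def)
    show "finite_measure ?Q" by unfold_locales
    fix A :: "nat \<Rightarrow> site set" and J :: "nat set"
    assume J: "finite J"
    then obtain n where n: "\<And>i. i \<in> J \<Longrightarrow> i \<le> n"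
      by (meson Max_ge)
    show "emeasure ?Q (prod_emb UNIV (\<lambda>_. count_space UNIV) J (Pi\<^sub>E J A)) =
        emeasure P (prod_emb UNIV (\<lambda>_. count_space UNIV) J (Pi\<^sub>E J A))"
    proof (rule eq)
      fix X Y :: path assume "\<And>i. i \<le> n \<Longrightarrow> X i = Y i"
      then have "\<forall>i\<in>J. X i = Y i" using n by auto
      then show "X \<in> prod_emb UNIV (\<lambda>_. count_space UNIV) J (Pi\<^sub>E J A) \<longleftrightarrow>
          Y \<in> prod_emb UNIV (\<lambda>_. count_space UNIV) J (Pi\<^sub>E J A)"
        by (auto simp: prod_emb_def PiE_iff)
    qed
  qed
qed

section \<open>Moments and speed\<close>

lemma measurable_path_component: "(\<lambda>X. X n) \<in> path_space \<rightarrow>\<^sub>M count_space UNIV"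
  unfolding path_space_def by (rule measurable_component_singleton) simp

text \<open>The right-hand side involves only the positions up to time \<open>n\<close>;
  measurability of \<open>T\<close> rests on this.\<close>

lemma T_eq_enat_iff:
  "T X = enat n \<longleftrightarrow> n \<ge> 1 \<and> X n - X (n - 1) = e2 \<and> (\<forall>m<n. m \<ge> 1 \<longrightarrow> X m - X (m - 1) \<noteq> e2)"
proof -
  let ?S = "{n. n \<ge> 1 \<and> X n - X (n - 1) = e2}"
  have first: "T X = enat n" if "n \<in> ?S" "\<forall>m<n. m \<notin> ?S" for n
    unfolding T_def using that by (intro antisym Inf_lower Inf_greatest) (auto simp: not_less[symmetric])
  show ?thesis
  proof
    assume T: "T X = enat n"
    then have "\<exists>m. m \<in> ?S" by (auto simp: T_def Inf_enat_def split: if_splits)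
    then have *: "(LEAST m. m \<in> ?S) \<in> ?S" "\<forall>m<(LEAST m. m \<in> ?S). m \<notin> ?S"
      by (rule LeastI_ex) (intro allI impI not_less_Least)
    with first[OF *] T show "n \<ge> 1 \<and> X n - X (n - 1) = e2 \<and> (\<forall>m<n. m \<ge> 1 \<longrightarrow> X m - X (m - 1) \<noteq> e2)"
      by auto
  qed (use first in auto)
qed

lemma measurable_T: "T \<in> path_space \<rightarrow>\<^sub>M count_space UNIV"
proof -
  have fin: "T -` {enat n} \<in> sets path_space" for n
    by (rule sets_coordinates[of n]) (auto simp: T_eq_enat_iff)
  have space: "space path_space = UNIV" by (simp add: path_space_def space_PiM)
  have "T -` {\<infinity>} = space path_space - (\<Union>n. T -` {enat n})"
    using space by auto
  then have inf: "T -` {\<infinity>} \<in> sets path_space" using fin by auto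
  show ?thesis
    unfolding measurable_count_space_eq2_countable
  proof (intro conjI ballI)
    fix t
    show "T -` {t} \<inter> space path_space \<in> sets path_space"
      using fin inf space by (cases t) auto
  qed simp
qed

lemma measurable_Delta: "Delta \<in> borel_measurable path_space"
proof -
  have "(\<lambda>X. real_of_int (fst (X n))) \<in> borel_measurable path_space" for n
    by (rule measurable_compose[OF measurable_path_component]) simp
  then show ?thesis
    unfolding Delta_def[abs_def]
    by (intro measurable_compose_countable[OF _ measurable_T, where f = "\<lambda>t X. real_of_int (fst (X (the_enat t)))"])
qed

lemma sets_LIMSEQ_path:
  "{X \<in> space path_space. (\<lambda>n. real_of_int (fst (X n)) / real n) \<longlonglongrightarrow> c} \<in> sets path_space"
proof -
  have [measurable]: "(\<lambda>X. real_of_int (fst (X n))) \<in> borel_measurable path_space" for n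
    by (rule measurable_compose[OF measurable_path_component]) simp
  \<comment> \<open>Tolerances \<open>1 / (k + 1)\<close> leave only countable quantifiers.\<close>
  have "f \<longlonglongrightarrow> c \<longleftrightarrow> (\<forall>k. \<exists>N. \<forall>n\<ge>N. \<bar>f n - c\<bar> < inverse (real (Suc k)))" for f :: "nat \<Rightarrow> real"
    unfolding lim_sequentially dist_real_def
    by (meson reals_Archimedean inverse_positive_iff_positive of_nat_0_less_iff order_less_trans zero_less_Suc)
  then show ?thesis by simp measurable
qed

section \<open>The block law and its moments\<close>

context three_valued_walk
begin

definition block_law :: "block pmf" where
  "block_law = embed_pmf block_weight"

lemma sums_p: "(\<lambda>k. p ^ Suc k * 1) sums (p / (1 - p))"
  using sums_mult[OF geometric_sums[of p], of p] p by simp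

lemma sums_a: "(\<lambda>k. a ^ k * 1) sums (1 / (1 - a))"
  using geometric_sums[of a] a_bounds by simp

text \<open>The sum over \<open>n\<close> after a rightward run; it cancels the factor
  \<open>1 / (1 - a)\<close> coming from the run itself. The trailing factor 1 is the value
  \<open>w 0\<close> of the constant integrand.\<close>

lemma last_step_sum: "p * (1 - p) + (1 - p) * (1 - p) * (1 - \<eta>) * 1 = (1 - p) * (1 - a)"
  by (simp add: a_def algebra_simps)

text \<open>Total mass 1: words entered at a trap carry mass \<open>p\<close>, all others together
  \<open>1 - p\<close>.\<close>

lemma pmf_block_law: "pmf block_law B = block_weight B"
proof -
  have "(\<integral>\<^sup>+B. ennreal (block_weight B) \<partial>count_space UNIV) =
      ennreal (p / (1 - p) * (1 - p) + 1 / (1 - a) * (p * (1 - p) + (1 - p) * (1 - p) * (1 - \<eta>) * 1))"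
    using nn_integral_block_weight[OF sums_bounce_weight_1 _ sums_p sums_a, simplified] by simp
  also note last_step_sum
  also have "p / (1 - p) * (1 - p) + 1 / (1 - a) * ((1 - p) * (1 - a)) = 1"
    using p a_bounds by simp
  finally show ?thesis
    unfolding block_law_def by (intro pmf_embed_pmf block_weight_nonneg) simp
qed

lemma nn_integral_block_law:
  assumes w: "(\<lambda>n. bounce_weight n * w n) sums W" "\<And>n. 0 \<le> w n"
    and u: "(\<lambda>k. p ^ Suc k * u True k) sums U" "(\<lambda>k. a ^ k * u False k) sums V" "\<And>b k. 0 \<le> u b k"
  shows "(\<integral>\<^sup>+B. ennreal (u (fst B) (fst (snd B)) * w (snd (snd B))) \<partial>measure_pmf block_law)
    = ennreal (U * W + V * (p * W + (1 - p) * (1 - p) * (1 - \<eta>) * w 0))"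
  unfolding nn_integral_measure_pmf pmf_block_law by (rule nn_integral_block_weight[OF assms])

lemma walk_law_eq_distr:
  "walk_law \<alpha> \<beta> p q = distr (\<Pi>\<^sub>M i\<in>UNIV. measure_pmf block_law) path_space block_walk"
  unfolding walk_law_def
proof (rule distr_block_walk_eq[symmetric])
  fix Bs
  show "emeasure (annealed (site_law \<alpha> \<beta> p q)) (cyl (words Bs)) = (\<Prod>r<length Bs. ennreal (pmf block_law (Bs ! r)))"
    unfolding emeasure_annealed_cyl_words prod_site_factor_means pmf_block_law ..
qed (rule sets_annealed prob_space_annealed)+

text \<open>Displacement is the difference of these two straight-run lengths, and duration is their
  sum plus \<open>2 * n + 1\<close>. Each part is nonnegative and of the product form that the
  integral formula accepts.\<close>

abbreviation rights :: "bool \<Rightarrow> nat \<Rightarrow> real" where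
  "rights b k \<equiv> if b then 0 else real k"

abbreviation lefts :: "bool \<Rightarrow> nat \<Rightarrow> real" where
  "lefts b k \<equiv> if b then real (Suc k) else 0"

lemma sums_rights: "(\<lambda>k. p ^ Suc k * rights True k) sums 0" "(\<lambda>k. a ^ k * rights False k) sums (a / (1 - a)\<^sup>2)"
  using geometric_sums_linear(1)[of a] a_bounds by simp_all

lemma sums_lefts: "(\<lambda>k. p ^ Suc k * lefts True k) sums (p / (1 - p)\<^sup>2)" "(\<lambda>k. a ^ k * lefts False k) sums 0"
  using geometric_sums_linear(2)[of p] p by (simp_all del: of_nat_Suc)

lemma nn_integral_rights:
  "(\<integral>\<^sup>+B. ennreal (rights (fst B) (fst (snd B))) \<partial>measure_pmf block_law) = ennreal ((1 - p)\<^sup>2 * \<eta> / (1 - a))"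
proof -
  have "(\<integral>\<^sup>+B. ennreal (rights (fst B) (fst (snd B)) * 1) \<partial>measure_pmf block_law) =
      ennreal (0 * (1 - p) + a / (1 - a)\<^sup>2 * ((1 - p) * (1 - a)))"
    unfolding last_step_sum[symmetric]
    by (rule nn_integral_block_law[OF sums_bounce_weight_1 _ sums_rights]) auto
  also have "0 * (1 - p) + a / (1 - a)\<^sup>2 * ((1 - p) * (1 - a)) = (1 - p) * a / (1 - a)"
    using a_bounds by (simp add: power2_eq_square)
  also have "(1 - p) * a = (1 - p)\<^sup>2 * \<eta>"
    by (simp add: a_def power2_eq_square)
  finally show ?thesis by simp
qed

lemma nn_integral_lefts:
  "(\<integral>\<^sup>+B. ennreal (lefts (fst B) (fst (snd B))) \<partial>measure_pmf block_law) = ennreal (p / (1 - p))"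
proof -
  have "(\<integral>\<^sup>+B. ennreal (lefts (fst B) (fst (snd B)) * 1) \<partial>measure_pmf block_law) =
      ennreal (p / (1 - p)\<^sup>2 * (1 - p) + 0 * ((1 - p) * (1 - a)))"
    unfolding last_step_sum[symmetric]
    by (rule nn_integral_block_law[OF sums_bounce_weight_1 _ sums_lefts]) auto
  also have "p / (1 - p)\<^sup>2 * (1 - p) + 0 * ((1 - p) * (1 - a)) = p / (1 - p)"
    using p by (simp add: power2_eq_square)
  finally show ?thesis by (simp del: of_nat_Suc)
qed

lemma nn_integral_vertical:
  "(\<integral>\<^sup>+B. ennreal (2 * real (snd (snd B)) + 1) \<partial>measure_pmf block_law) =
    ennreal (p * (1 + 2 * \<xi>) + (1 - p) * (p * (1 + 2 * \<xi>) + (1 - p) * (1 - \<eta>)) / (1 - a))"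
proof -
  have "(\<integral>\<^sup>+B. ennreal (1 * (2 * real (snd (snd B)) + 1)) \<partial>measure_pmf block_law) =
      ennreal (p / (1 - p) * ((1 - p) * (1 + 2 * \<xi>)) +
        1 / (1 - a) * (p * ((1 - p) * (1 + 2 * \<xi>)) + (1 - p) * (1 - p) * (1 - \<eta>) * (2 * real 0 + 1)))"
    by (rule nn_integral_block_law[OF sums_bounce_weight_dur _ sums_p sums_a]) auto
  also have "p / (1 - p) * ((1 - p) * (1 + 2 * \<xi>)) = p * (1 + 2 * \<xi>)"
    using p by simp
  also have "p * ((1 - p) * (1 + 2 * \<xi>)) + (1 - p) * (1 - p) * (1 - \<eta>) * (2 * real 0 + 1) =
      (1 - p) * (p * (1 + 2 * \<xi>) + (1 - p) * (1 - \<eta>))"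
    by (simp add: algebra_simps)
  finally show ?thesis by simp
qed

definition mean_T :: real where
  "mean_T = p * (1 + 2 * \<xi>) + p / (1 - p) + (1 - p) / (1 - a) * (1 + 2 * p * \<xi>)"

definition mean_Delta :: real where
  "mean_Delta = (1 - p)\<^sup>2 * \<eta> / (1 - a) - p / (1 - p)"

lemma dur_eq: "real (dur B) = rights (fst B) (fst (snd B)) + (lefts (fst B) (fst (snd B)) + (2 * real (snd (snd B)) + 1))"
  by (cases B) simp

lemma disp_eq: "real_of_int (disp B) = rights (fst B) (fst (snd B)) - lefts (fst B) (fst (snd B))"
  by (cases B) simp

lemma abs_disp_le: "\<bar>disp B\<bar> \<le> int (dur B)"
  by (cases B) simp

lemma mean_T_pos: "0 < mean_T"
proof -
  have "0 < 1 + 2 * p * \<xi>" "0 < 1 + 2 * \<xi>"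
    using p \<xi>_nonneg by (auto intro!: add_pos_nonneg)
  then have "0 < p * (1 + 2 * \<xi>)" "0 < p / (1 - p)" "0 < (1 - p) / (1 - a) * (1 + 2 * p * \<xi>)"
    using p a_bounds by simp_all
  then show ?thesis
    unfolding mean_T_def by linarith
qed

lemma nn_integral_dur: "(\<integral>\<^sup>+B. ennreal (real (dur B)) \<partial>measure_pmf block_law) = ennreal mean_T"
proof -
  let ?A = "(1 - p)\<^sup>2 * \<eta> / (1 - a)" and ?B = "p / (1 - p)"
    and ?C = "p * (1 + 2 * \<xi>) + (1 - p) * (p * (1 + 2 * \<xi>) + (1 - p) * (1 - \<eta>)) / (1 - a)"
  have "(\<integral>\<^sup>+B. ennreal (real (dur B)) \<partial>measure_pmf block_law) = ennreal ?A + (ennreal ?B + ennreal ?C)"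
    unfolding dur_eq nn_integral_rights[symmetric] nn_integral_lefts[symmetric] nn_integral_vertical[symmetric]
    by (subst nn_integral_add[symmetric]; simp del: of_nat_Suc)+
  also have "\<dots> = ennreal (?A + (?B + ?C))"
    using p \<eta>_bounds a_bounds \<xi>_nonneg by (subst ennreal_plus; simp)+
  also have "?A + (?B + ?C) = p * (1 + 2 * \<xi>) + ?B + ((1 - p)\<^sup>2 * \<eta> + (1 - p) * (p * (1 + 2 * \<xi>) + (1 - p) * (1 - \<eta>))) / (1 - a)"
    by (simp add: add_divide_distrib)
  \<comment> \<open>The \<open>\<eta>\<close> from the mean rightward run cancels the one from the
    isolated term at \<open>n = 0\<close>.\<close>
  also have "(1 - p)\<^sup>2 * \<eta> + (1 - p) * (p * (1 + 2 * \<xi>) + (1 - p) * (1 - \<eta>)) = (1 - p) * (1 + 2 * p * \<xi>)"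
    by (simp add: power2_eq_square algebra_simps)
  finally show ?thesis by (simp add: mean_T_def)
qed

lemma has_bochner_integral_dur: "has_bochner_integral (measure_pmf block_law) (\<lambda>B. real (dur B)) mean_T"
  by (rule has_bochner_integral_nn_integral) (use mean_T_pos nn_integral_dur in auto)

lemma has_bochner_integral_disp:
  "has_bochner_integral (measure_pmf block_law) (\<lambda>B. real_of_int (disp B)) mean_Delta"
proof -
  have "has_bochner_integral (measure_pmf block_law) (\<lambda>B. rights (fst B) (fst (snd B))) ((1 - p)\<^sup>2 * \<eta> / (1 - a))"
    by (rule has_bochner_integral_nn_integral) (use p \<eta>_bounds a_bounds nn_integral_rights in auto)
  moreover have "has_bochner_integral (measure_pmf block_law) (\<lambda>B. lefts (fst B) (fst (snd B))) (p / (1 - p))"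
    by (rule has_bochner_integral_nn_integral) (use p nn_integral_lefts in auto)
  ultimately show ?thesis
    unfolding disp_eq mean_Delta_def by (rule has_bochner_integral_diff)
qed

text \<open>The square of the duration is not of product form. Bounding it by twice the sum of
  squares of a part in \<open>n\<close> and a part in \<open>k\<close> reduces it to two integrals
  that are.\<close>

lemma integrable_dur_sq: "integrable (measure_pmf block_law) (\<lambda>B. (real (dur B))\<^sup>2)"
proof -
  define S where "S r = (\<Sum>n. r ^ n * (2 * real n + 1)\<^sup>2)" for r :: real
  have S: "(\<lambda>n. r ^ n * (2 * real n + 1)\<^sup>2) sums S r" if "0 < r" "r < 1" for r
    unfolding S_def using that by (intro summable_sums summable_geometric_quadratic) auto
  have "(\<integral>\<^sup>+B. ennreal (1 * (2 * real (snd (snd B)) + 1)\<^sup>2) \<partial>measure_pmf block_law) < \<infinity>"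
    by (subst nn_integral_block_law[OF sums_bounce_weight[OF S[OF \<alpha>] S[OF \<beta>]] _ sums_p sums_a]) auto
  moreover have "(\<integral>\<^sup>+B. ennreal ((2 * real (fst (snd B)) + 1)\<^sup>2 * 1) \<partial>measure_pmf block_law) < \<infinity>"
  proof (subst nn_integral_block_law[OF sums_bounce_weight_1, where u = "\<lambda>_ k. (2 * real k + 1)\<^sup>2" and V = "S a" and U = "p * S p"])
    show "(\<lambda>k. p ^ Suc k * (2 * real k + 1)\<^sup>2) sums (p * S p)"
      using sums_mult[OF S[OF p], of p] by (simp add: ac_simps)
  qed (use S[OF a_bounds] in auto)
  ultimately have fin: "(\<integral>\<^sup>+B. ennreal ((2 * real (snd (snd B)) + 1)\<^sup>2) \<partial>measure_pmf block_law) +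
      (\<integral>\<^sup>+B. ennreal ((2 * real (fst (snd B)) + 1)\<^sup>2) \<partial>measure_pmf block_law) < \<infinity>"
    by simp
  have sq: "(x + y)\<^sup>2 \<le> 2 * (x\<^sup>2 + y\<^sup>2)" for x y :: real
    using sum_squares_bound[of x y] by (simp add: power2_sum)
  have "(real (dur B))\<^sup>2 \<le> 2 * ((2 * real (snd (snd B)) + 1)\<^sup>2 + (2 * real (fst (snd B)) + 1)\<^sup>2)" for B
  proof -
    have "real (dur B) \<le> (2 * real (snd (snd B)) + 1) + (2 * real (fst (snd B)) + 1)"
      by (cases B) simp
    then have "(real (dur B))\<^sup>2 \<le> ((2 * real (snd (snd B)) + 1) + (2 * real (fst (snd B)) + 1))\<^sup>2"
      by (intro power_mono) auto
    also have "\<dots> \<le> 2 * ((2 * real (snd (snd B)) + 1)\<^sup>2 + (2 * real (fst (snd B)) + 1)\<^sup>2)"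
      by (rule sq)
    finally show ?thesis .
  qed
  then have "(\<integral>\<^sup>+B. ennreal ((real (dur B))\<^sup>2) \<partial>measure_pmf block_law) \<le>
      (\<integral>\<^sup>+B. 2 * (ennreal ((2 * real (snd (snd B)) + 1)\<^sup>2) + ennreal ((2 * real (fst (snd B)) + 1)\<^sup>2)) \<partial>measure_pmf block_law)"
    by (intro nn_integral_mono) (simp add: ennreal_plus[symmetric] ennreal_numeral[symmetric] ennreal_mult[symmetric] ennreal_leI del: ennreal_plus ennreal_numeral)
  also have "\<dots> < \<infinity>"
    using fin by (simp add: nn_integral_cmult nn_integral_add ennreal_mult_less_top)
  finally show ?thesis
    by (intro integrableI_nonneg) auto
qed

section \<open>Transfer from block sequences to the walk\<close>

lemma block_component:
  "distr (\<Pi>\<^sub>M i\<in>UNIV. measure_pmf block_law) (measure_pmf block_law) (\<lambda>w. w (0::nat)) = measure_pmf block_law"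
  by (rule distr_PiM_component) (auto simp: prob_space_measure_pmf)

lemma measurable_block_component [measurable]:
  "(\<lambda>w. w i) \<in> (\<Pi>\<^sub>M i\<in>UNIV. measure_pmf block_law) \<rightarrow>\<^sub>M measure_pmf block_law"
  by (rule measurable_component_singleton) simp

lemma has_bochner_integral_Delta: "has_bochner_integral (walk_law \<alpha> \<beta> p q) Delta mean_Delta"
proof -
  have "has_bochner_integral (distr (\<Pi>\<^sub>M i\<in>UNIV. measure_pmf block_law) (measure_pmf block_law) (\<lambda>w. w (0::nat)))
      (\<lambda>B. real_of_int (disp B)) mean_Delta"
    unfolding block_component by (rule has_bochner_integral_disp)
  then have "has_bochner_integral (\<Pi>\<^sub>M i\<in>UNIV. measure_pmf block_law) (\<lambda>w. Delta (block_walk w)) mean_Delta"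
    unfolding Delta_block_walk
    by (simp add: has_bochner_integral_iff integrable_distr_eq integral_distr)
  then show ?thesis
    unfolding walk_law_eq_distr using measurable_block_walk[of block_law] measurable_Delta
    by (simp add: has_bochner_integral_iff integrable_distr_eq integral_distr)
qed

lemma E_T_eq: "E_T \<alpha> \<beta> p q = ennreal mean_T"
proof -
  have [measurable]: "(\<lambda>X. ennreal_of_enat (T X)) \<in> borel_measurable path_space"
    by (rule measurable_compose[OF measurable_T]) simp
  have "E_T \<alpha> \<beta> p q = (\<integral>\<^sup>+w. ennreal_of_enat (T (block_walk w)) \<partial>(\<Pi>\<^sub>M i\<in>UNIV. measure_pmf block_law))"
    unfolding E_T_def walk_law_eq_distr by (rule nn_integral_distr[OF measurable_block_walk]) simp
  also have "\<dots> = (\<integral>\<^sup>+w. ennreal (real (dur (w (0::nat)))) \<partial>(\<Pi>\<^sub>M i\<in>UNIV. measure_pmf block_law))"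
    by (simp add: T_block_walk ennreal_of_nat_eq_real_of_nat)
  also have "\<dots> = (\<integral>\<^sup>+B. ennreal (real (dur B)) \<partial>distr (\<Pi>\<^sub>M i\<in>UNIV. measure_pmf block_law) (measure_pmf block_law) (\<lambda>w. w (0::nat)))"
    by (rule nn_integral_distr[symmetric]) auto
  finally show ?thesis
    unfolding block_component nn_integral_dur .
qed

lemma v1_eq: "v1 \<alpha> \<beta> p q = mean_Delta / mean_T"
  using has_bochner_integral_Delta mean_T_pos
  by (simp add: v1_def E_T_eq E_Delta_def has_bochner_integral_iff)

lemma AE_walk_law_speed: "AE X in walk_law \<alpha> \<beta> p q. (\<lambda>n. real_of_int (fst (X n)) / real n) \<longlonglongrightarrow> mean_Delta / mean_T"
proof -
  let ?M = "\<Pi>\<^sub>M (i::nat)\<in>UNIV. measure_pmf block_law"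
  have int: "integrable (measure_pmf block_law) (\<lambda>B. real (dur B))" "integrable (measure_pmf block_law) (\<lambda>B. real_of_int (disp B))"
    and ex: "measure_pmf.expectation block_law (\<lambda>B. real (dur B)) = mean_T"
      "measure_pmf.expectation block_law (\<lambda>B. real_of_int (disp B)) = mean_Delta"
    using has_bochner_integral_dur has_bochner_integral_disp by (auto simp: has_bochner_integral_iff)
  have disp: "\<bar>real_of_int (disp B)\<bar> \<le> real (dur B)" for B
    using abs_disp_le[of B] by linarith
  \<comment> \<open>Displacements are signed, while the strong law is for nonnegative variables.
    Since the displacement is at most the duration in absolute value, the law is applied to their
    sum, and the limit for the durations is subtracted afterwards.\<close>
  have sq: "integrable (measure_pmf block_law) (\<lambda>B. (real (dur B) + real_of_int (disp B))\<^sup>2)"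
  proof (rule Bochner_Integration.integrable_bound)
    show "integrable (measure_pmf block_law) (\<lambda>B. 4 * (real (dur B))\<^sup>2)"
      by (intro integrable_mult_right integrable_dur_sq)
    have "(real (dur B) + real_of_int (disp B))\<^sup>2 \<le> (2 * real (dur B))\<^sup>2" for B
      using disp[of B] by (intro power_mono) linarith+
    then show "AE B in measure_pmf block_law. norm ((real (dur B) + real_of_int (disp B))\<^sup>2) \<le> norm (4 * (real (dur B))\<^sup>2)"
      by (simp add: power_mult_distrib)
  qed simp
  have "AE w in ?M. (\<lambda>n. (\<Sum>i<n. real (dur (w i))) / real n) \<longlonglongrightarrow> mean_T"
    unfolding ex[symmetric] by (intro strong_law_pmf_nonneg integrable_dur_sq) simp
  moreover have "AE w in ?M. (\<lambda>n. (\<Sum>i<n. real (dur (w i)) + real_of_int (disp (w i))) / real n) \<longlonglongrightarrow>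
      measure_pmf.expectation block_law (\<lambda>B. real (dur B) + real_of_int (disp B))"
    by (intro strong_law_pmf_nonneg sq) (use disp in \<open>smt (verit)\<close>)
  ultimately have "AE w in ?M. (\<lambda>n. real_of_int (fst (block_walk w n)) / real n) \<longlonglongrightarrow> mean_Delta / mean_T"
  proof eventually_elim
    case (elim w)
    have "(\<lambda>n. (\<Sum>i<n. real (dur (w i)) + real_of_int (disp (w i))) / real n - (\<Sum>i<n. real (dur (w i))) / real n)
        \<longlonglongrightarrow> (mean_T + mean_Delta) - mean_T"
      using elim int ex by (intro tendsto_diff) simp_all
    then have lim: "(\<lambda>n. (\<Sum>i<n. real_of_int (disp (w i))) / real n) \<longlonglongrightarrow> mean_Delta"
      by (simp add: sum.distrib add_divide_distrib)
    show ?case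
    \<comment> \<open>Renewals are the ends of words. Every step changes the first coordinate by at
      most 1, so since the last renewal it has moved by no more than the elapsed time.\<close>
    proof (rule renewal_LIMSEQ[OF _ strict_mono_block_time mean_T_pos _ lim])
      show "block_time w 0 = 0" by (simp add: block_time_def)
      show "(\<lambda>k. real (block_time w k) / real k) \<longlonglongrightarrow> mean_T"
        using elim by (simp add: block_time_def)
      fix k n assume "block_time w k \<le> n"
      then have "\<bar>fst (block_walk w n) - (\<Sum>i<k. disp (w i))\<bar> \<le> int (n - block_time w k)"
        using abs_fst_block_walk_diff_le[of "block_time w k" n w] by (simp add: block_walk_block_time)
      then have "real_of_int \<bar>fst (block_walk w n) - (\<Sum>i<k. disp (w i))\<bar> \<le> real_of_int (int (n - block_time w k))"
        by (simp only: of_int_le_iff)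
      then show "\<bar>real_of_int (fst (block_walk w n)) - (\<Sum>i<k. real_of_int (disp (w i)))\<bar> \<le> real (n - block_time w k)"
        by (simp only: of_int_abs of_int_diff of_int_sum of_int_of_nat_eq)
    qed
  qed
  then show ?thesis
    unfolding walk_law_eq_distr
    by (subst AE_distr_iff[OF measurable_block_walk sets_LIMSEQ_path]) simp_all
qed

end

section \<open>Moments, speed and failure of monotonicity\<close>

theorem mainTheorem11:
  "(\<forall>\<alpha> \<beta> p q :: real.
      0 < \<alpha> \<and> \<alpha> < 1 \<and> 0 < \<beta> \<and> \<beta> < 1 \<and> 0 < p \<and> p < 1 \<and> 0 \<le> q \<and> q \<le> 1 \<longrightarrow>
      (let \<eta> = q * \<alpha> + (1 - q) * \<beta>;
           a = (1 - p) * \<eta>;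
           \<xi> = q * \<alpha> / (1 - \<alpha>) + (1 - q) * \<beta> / (1 - \<beta>)
       in integrable (walk_law \<alpha> \<beta> p q) Delta \<and>
          E_Delta \<alpha> \<beta> p q = (1 - p)\<^sup>2 * \<eta> / (1 - a) - p / (1 - p) \<and>
          E_T \<alpha> \<beta> p q =
            ennreal (p * (1 + 2 * \<xi>) + p / (1 - p) + (1 - p) / (1 - a) * (1 + 2 * p * \<xi>)) \<and>
          (AE X in walk_law \<alpha> \<beta> p q.
             (\<lambda>n. real_of_int (fst (X n)) / real n) \<longlonglongrightarrow> v1 \<alpha> \<beta> p q))) \<and>
   (\<exists>\<alpha> \<beta> p :: real.
      0 < \<alpha> \<and> \<alpha> < 1 \<and> 0 < \<beta> \<and> \<beta> < 1 \<and> 0 < p \<and> p < 1 \<and>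
      \<not> mono_on {0..1} (\<lambda>q. v1 \<alpha> \<beta> p q))"
proof (intro conjI allI impI)
  fix \<alpha> \<beta> p q :: real
  assume "0 < \<alpha> \<and> \<alpha> < 1 \<and> 0 < \<beta> \<and> \<beta> < 1 \<and> 0 < p \<and> p < 1 \<and> 0 \<le> q \<and> q \<le> 1"
  then interpret three_valued_walk \<alpha> \<beta> p q by unfold_locales auto
  show "let \<eta> = q * \<alpha> + (1 - q) * \<beta>;
           a = (1 - p) * \<eta>;
           \<xi> = q * \<alpha> / (1 - \<alpha>) + (1 - q) * \<beta> / (1 - \<beta>)
       in integrable (walk_law \<alpha> \<beta> p q) Delta \<and>
          E_Delta \<alpha> \<beta> p q = (1 - p)\<^sup>2 * \<eta> / (1 - a) - p / (1 - p) \<and>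
          E_T \<alpha> \<beta> p q =
            ennreal (p * (1 + 2 * \<xi>) + p / (1 - p) + (1 - p) / (1 - a) * (1 + 2 * p * \<xi>)) \<and>
          (AE X in walk_law \<alpha> \<beta> p q.
             (\<lambda>n. real_of_int (fst (X n)) / real n) \<longlonglongrightarrow> v1 \<alpha> \<beta> p q)"
    unfolding Let_def \<eta>_def[symmetric] a_def[symmetric] \<xi>_def[symmetric]
      mean_T_def[symmetric] mean_Delta_def[symmetric] v1_eq E_T_eq
    using has_bochner_integral_Delta AE_walk_law_speed
    by (auto simp: has_bochner_integral_iff E_Delta_def)
next
  text \<open>A drift \<open>\<alpha>\<close> close to 1 makes the walk bounce for a long time before each trap,
    while the displacement stays bounded.\<close>
  define \<alpha> \<beta> p :: real where params: "\<alpha> = 999/1000" "\<beta> = 1/2" "p = 1/10"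
  interpret v0: three_valued_walk \<alpha> \<beta> p 0 by unfold_locales (simp_all add: params)
  interpret v1: three_valued_walk \<alpha> \<beta> p 1 by unfold_locales (simp_all add: params)
  \<comment> \<open>Passing from \<open>q = 0\<close> to \<open>q = 1\<close> raises
    \<open>\<xi>\<close> from 1 to 999: the mean displacement grows from about 0.6 to 7.9, the mean
    duration from about 2.4 to 1991, and the speed drops from about 0.26 to 0.004.\<close>
  have "v1 \<alpha> \<beta> p 1 < v1 \<alpha> \<beta> p 0"
    unfolding v0.v1_eq v1.v1_eq v0.mean_Delta_def v0.mean_T_def v0.a_def v0.\<eta>_def v0.\<xi>_def
      v1.mean_Delta_def v1.mean_T_def v1.a_def v1.\<eta>_def v1.\<xi>_def
    unfolding params
    by (simp add: power2_eq_square)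
  then have "\<not> mono_on {0..1} (\<lambda>q. v1 \<alpha> \<beta> p q)"
    by (auto dest: mono_onD[of _ _ 0 1])
  then show "\<exists>\<alpha> \<beta> p :: real.
      0 < \<alpha> \<and> \<alpha> < 1 \<and> 0 < \<beta> \<and> \<beta> < 1 \<and> 0 < p \<and> p < 1 \<and>
      \<not> mono_on {0..1} (\<lambda>q. v1 \<alpha> \<beta> p q)"
    using v0.\<alpha> v0.\<beta> v0.p by blast
qed

end
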